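(* Let $n\ge 1$, let $u:\mathbb{D}^n\to\mathbb{C}$ be a nonzero analytic function and let $v:\mathbb{D}^n\to\mathbb{D}^n$, $v(z_1,\ldots,z_n)=(v_1(z_1),\ldots,v_n(z_n))$, be an analytic self-map of $\mathbb{D}^n$ such that $W_{u,v}$ is bounded on $H^2(\mathbb{D}^n)$. Then $W_{u,v}$ is $\mathcal{J}$-symmetric if and only if $$u(z_1,\ldots,z_n)=a\prod_{i=1}^{n}\frac{1}{1-c_iz_i}\quad\text{and}\quad v_j(z_j)=\frac{(d_j-c_j^2)z_j+c_j}{1-c_jz_j}\quad\text{for } j=1,\ldots,n,$$ where $a=u(0,\ldots,0)$, $c_j=v_j(0)$ and $d_j=v_j'(0)$ for $j=1,\ldots,n$.
   Context: $\mathbb{D}$ is the open unit disk in $\mathbb{C}$, $\mathbb{D}^n$ the polydisk, $\mathbb{T}^n$ the torus with normalized Haar measure $\sigma$. $H^2(\mathbb{D}^n)$ is the Hardy space of analytic $f:\mathbb{D}^n\to\mathbb{C}$ with $\|f\|^2=\sup_{0<r<1}\int_{\mathbb{T}^n}|f(r\zeta)|^2\,d\sigma(\zeta)<\infty$; it is a Hilbert space in which the monomials $\prod_i z_i^{m_i}$ ($m_i\ge 0$) form an orthonormal basis. In $v=(v_1,\ldots,v_n)$ each $v_j$ is an analytic self-map of $\mathbb{D}$ depending only on $z_j$. "Nonzero" means not identically zero. The weighted composition operator is $W_{u,v}f(z)=u(z)f(v(z))$. The standard conjugation on $H^2(\mathbb{D}^n)$ is $\mathcal{J}f(z)=\overline{f(\bar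 z)}$, where $\bar z=(\bar z_1,\ldots,\bar z_n)$. A bounded operator $T$ is $\mathcal{J}$-symmetric (complex symmetric with conjugation $\mathcal{J}$) if $T=\mathcal{J}T^*\mathcal{J}$. *)

theory Defs
  imports "HOL-Complex_Analysis.Complex_Analysis"
begin

definition polydisc :: "(complex ^ 'n) set" where
  "polydisc = {z. \<forall>i. norm (z $ i) < 1}"

text \<open>Analytic functions of several complex variables: Frechet differentiable
  with complex-linear derivative at every point.\<close>

definition holomorphic_vec_on :: "(complex ^ 'n \<Rightarrow> complex) \<Rightarrow> (complex ^ 'n) set \<Rightarrow> bool"
    (infixl "holomorphic'_vec'_on" 50) where
  "f holomorphic_vec_on S \<longleftrightarrow>
     (\<forall>z\<in>S. \<exists>L. (f has_derivative L) (at z within S) \<and> (\<forall>c x. L (c *s x) = c * L x))"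

text \<open>Normalized Haar measure of the torus, as a Borel measure on the ambient space:
  the image of Lebesgue measure on the unit cube under
  \<open>t \<mapsto> (exp (2 \<pi> \<i> t\<^sub>j))\<^sub>j\<close>.\<close>

definition torus_measure :: "(complex ^ 'n) measure" where
  "torus_measure =
     distr (uniform_measure lborel (cbox 0 (1 :: real ^ 'n))) borel
       (\<lambda>t. \<chi> j. cis (2 * pi * t $ j))"

definition hardy_sqnorm :: "(complex ^ 'n \<Rightarrow> complex) \<Rightarrow> ennreal" where
  "hardy_sqnorm f =
     (SUP r\<in>{0<..<1::real}. \<integral>\<^sup>+ \<zeta>. ennreal ((norm (f (r *\<^sub>R \<zeta>)))\<^sup>2) \<partial>torus_measure)"

text \<open>A function on the polydisc is represented by its extension by zero, so that
  elements of the Hardy space are equal iff they agree on the polydisc.\<close>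

definition hardy_space :: "(complex ^ 'n \<Rightarrow> complex) set" where
  "hardy_space =
     {f. f holomorphic_vec_on polydisc \<and> (\<forall>z. z \<notin> polydisc \<longrightarrow> f z = 0) \<and> hardy_sqnorm f < \<infinity>}"

definition hardy_norm :: "(complex ^ 'n \<Rightarrow> complex) \<Rightarrow> real" where
  "hardy_norm f = sqrt (enn2real (hardy_sqnorm f))"

text \<open>The inner product inducing the norm, recovered by polarization; it is linear in
  the first argument and conjugate-linear in the second.\<close>

definition hardy_inner :: "(complex ^ 'n \<Rightarrow> complex) \<Rightarrow> (complex ^ 'n \<Rightarrow> complex) \<Rightarrow> complex" where
  "hardy_inner f g =
     (of_real ((hardy_norm (\<lambda>z. f z + g z))\<^sup>2) - of_real ((hardy_norm (\<lambda>z. f z - g z))\<^sup>2)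
      + \<i> * of_real ((hardy_norm (\<lambda>z. f z + \<i> * g z))\<^sup>2)
      - \<i> * of_real ((hardy_norm (\<lambda>z. f z - \<i> * g z))\<^sup>2)) / 4"

type_synonym 'n hardy_operator = "(complex ^ 'n \<Rightarrow> complex) \<Rightarrow> (complex ^ 'n \<Rightarrow> complex)"

definition bounded_hardy_operator :: "('n::finite) hardy_operator \<Rightarrow> bool" where
  "bounded_hardy_operator T \<longleftrightarrow>
     (\<forall>f\<in>hardy_space. T f \<in> hardy_space) \<and>
     (\<forall>f\<in>hardy_space. \<forall>g\<in>hardy_space. T (\<lambda>z. f z + g z) = (\<lambda>z. T f z + T g z)) \<and>
     (\<forall>c. \<forall>f\<in>hardy_space. T (\<lambda>z. c * f z) = (\<lambda>z. c * T f z)) \<and>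
     (\<exists>C. \<forall>f\<in>hardy_space. hardy_norm (T f) \<le> C * hardy_norm f)"

definition hardy_adjoint :: "('n::finite) hardy_operator \<Rightarrow> ('n::finite) hardy_operator" where
  "hardy_adjoint T g =
     (THE h. h \<in> hardy_space \<and> (\<forall>f\<in>hardy_space. hardy_inner (T f) g = hardy_inner f h))"

definition standard_conjugation :: "('n::finite) hardy_operator" where
  "standard_conjugation f z = cnj (f (\<chi> i. cnj (z $ i)))"

definition J_symmetric :: "('n::finite) hardy_operator \<Rightarrow> bool" where
  "J_symmetric T \<longleftrightarrow> bounded_hardy_operator T \<and>
     (\<forall>f\<in>hardy_space.
        T f = standard_conjugation (hardy_adjoint T (standard_conjugation f)))"

definition weighted_composition ::
    "(complex ^ 'n \<Rightarrow> complex) \<Rightarrow> (complex ^ 'n \<Rightarrow> complex ^ 'n) \<Rightarrow> ('n::finite) hardy_operator" where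
  "weighted_composition u v f z = (if z \<in> polydisc then u z * f (v z) else 0)"

end

(* Writing K_w for the reproducing kernel, W* K_w = conj(u(w)) K_(v(w)) and J K_w = K_(conj w), so
   J-symmetry yields u(z) prod 1/(1 - w_i v_i(z_i)) = u(w) prod 1/(1 - v_i(w_i) z_i). Putting w = 0
   determines u; restricting to one coordinate and differentiating at w = 0 determines v.
   Conversely the formulas imply this identity, which says that <W K_w, g> = <K_w, J W J g> for
   all w and g; every dilate f(s z) is a torus average of kernels, and the dilates converge to f in norm.

   Power series are avoided: Cauchy's formula on the torus and Fubini show that the mean of
   A(r zeta) B(t conj(zeta)) depends on the product r t only and is symmetric in A and B. This makes
   the mean squares monotone in r, so that the inner product is the limit of the torus inner
   products as r tends to 1, and Cauchy's formula becomes the reproducing property. *)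

theory Submission
  imports Defs "HOL-Probability.Probability_Measure" "HOL-Real_Asymp.Real_Asymp"
begin

no_notation fps_nth (infixl \<open>$\<close> 75)

section \<open>Lebesgue measure on the unit cube\<close>

text \<open>The norm is a supremum over radii and the inner product is a polarization of it, so
  linearity and conjugate symmetry have to be read off from torus integrals. They pass to the inner
  product only once the supremum is known to be a limit, which is why monotonicity in the radius
  comes before all Hilbert space arguments. Its source: the mean of |f(s zeta)|^2 can be
  redistributed over two radii with product s^2, which makes mean squares midpoint convex in log r.

  For the converse, the adjoint is defined by a description, so J W J g is exhibited as an element
  with the defining property; kernels recover point values and give uniqueness. The dilation factor
  is taken to be a square sigma^2: one factor sigma is the radius at which Cauchy's formula samples
  f, the other keeps the kernel points sigma conj(zeta) inside the polydisc, where the kernel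
  identity holds. The same square turns the cross term in the norm of f minus its dilate into a mean
  square of f.\<close>

definition unit_cube :: "(real ^ 'n) measure" where
  "unit_cube = uniform_measure lborel (cbox 0 1)"

definition unit_interval :: "real measure" where
  "unit_interval = uniform_measure lborel {0..1}"

definition torus_point :: "real ^ 'n \<Rightarrow> complex ^ 'n" where
  "torus_point t = (\<chi> j. cis (2 * pi * t $ j))"

text \<open>Angle coordinates make the integrands continuous on all of \<open>real ^ 'n\<close>, so
  that integrability follows from compactness of the cube.\<close>

definition torus_mean :: "(complex ^ 'n \<Rightarrow> complex) \<Rightarrow> complex" where
  "torus_mean F = (\<integral>t. F (torus_point t) \<partial>unit_cube)"

lemma sets_unit_cube [measurable_cong, simp]: "sets (unit_cube :: (real ^ 'n) measure) = sets borel"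
  by (simp add: unit_cube_def)

lemma space_unit_cube [simp]: "space (unit_cube :: (real ^ 'n) measure) = UNIV"
  by (simp add: unit_cube_def)

lemma sets_unit_interval [measurable_cong, simp]: "sets unit_interval = sets borel"
  by (simp add: unit_interval_def)

lemma space_unit_interval [simp]: "space unit_interval = UNIV"
  by (simp add: unit_interval_def)

text \<open>\<open>ennreal\<close> sends negative numbers to 0, so the product formula also covers
  boxes that are empty because some \<open>b $ i\<close> is negative.\<close>

lemma emeasure_cbox_0_cart:
  fixes b :: "real ^ 'n"
  shows "emeasure lborel (cbox 0 b) = (\<Prod>i\<in>UNIV. ennreal (b $ i))"
proof (cases "\<forall>i. 0 \<le> b $ i")
  case True
  have "bij_betw (\<lambda>i. axis i 1) UNIV (Basis :: (real ^ 'n) set)"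
    by (auto simp: bij_betw_def inj_def axis_eq_axis Basis_vec_def)
  then have "(\<Prod>e\<in>Basis. b \<bullet> e) = (\<Prod>i\<in>UNIV. b $ i)"
    by (subst prod.reindex_bij_betw[symmetric]) (auto simp: inner_axis)
  then show ?thesis
    using True by (auto simp: emeasure_lborel_cbox_eq Basis_vec_def inner_axis prod_ennreal prod_nonneg)
next
  case False
  then obtain i where i: "b $ i < 0" by (auto simp: not_le)
  then have "cbox 0 b = {}"
    by (auto simp: interval_eq_empty_cart)
  moreover have "(\<Prod>i\<in>UNIV. ennreal (b $ i)) = 0"
    using i by (intro prod_zero) (auto simp: ennreal_neg intro!: exI[of _ i])
  ultimately show ?thesis by simp
qed

lemma prob_space_unit_cube: "prob_space (unit_cube :: (real ^ 'n) measure)"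
  unfolding unit_cube_def by (rule prob_space_uniform_measure) (simp_all add: emeasure_cbox_0_cart)

lemma prob_space_unit_interval: "prob_space unit_interval"
  unfolding unit_interval_def by (rule prob_space_uniform_measure) simp_all

text \<open>The index set S serves two instances: all coordinates, for the orthant below a, and all
  but one, for the coordinates that survive when one is resampled.\<close>

lemma emeasure_unit_cube_halfspaces:
  fixes a :: "real ^ 'n"
  shows "emeasure unit_cube {t. \<forall>i\<in>S. t $ i \<le> a $ i} = (\<Prod>i\<in>S. ennreal (min 1 (a $ i)))"
proof -
  have [measurable]: "{t. \<forall>i\<in>S. t $ i \<le> a $ i} \<in> sets borel"
    by measurable
  have "cbox 0 1 \<inter> {t. \<forall>i\<in>S. t $ i \<le> a $ i} = cbox 0 (\<chi> i. if i \<in> S then min 1 (a $ i) else 1)"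
    by (auto simp: mem_box_cart split: if_splits)
  then have "emeasure unit_cube {t. \<forall>i\<in>S. t $ i \<le> a $ i} =
      (\<Prod>i\<in>UNIV. ennreal (if i \<in> S then min 1 (a $ i) else 1))"
    by (simp add: unit_cube_def emeasure_cbox_0_cart divide_ennreal_def)
  also have "\<dots> = (\<Prod>i\<in>S. ennreal (min 1 (a $ i)))"
    by (rule prod.mono_neutral_cong_right) auto
  finally show ?thesis .
qed

lemma emeasure_unit_interval_atMost: "emeasure unit_interval {..s} = ennreal (min 1 s)"
proof -
  have "{0..1} \<inter> {..s} = {0..min 1 s}" by auto
  then show ?thesis
    by (simp add: unit_interval_def divide_ennreal_def emeasure_lborel_Icc_eq ennreal_neg)
qed

lemma measurable_vec [measurable (raw)]:
  fixes F :: "'a \<Rightarrow> 'n::finite \<Rightarrow> real"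
  assumes "\<And>i. (\<lambda>x. F x i) \<in> borel_measurable M"
  shows "(\<lambda>x. \<chi> i. F x i) \<in> borel_measurable M"
  using assms by (subst borel_measurable_euclidean_space) (auto simp: Basis_vec_def inner_axis)

lemma measurable_vec_nth [measurable]: "(\<lambda>x :: real ^ 'n. x $ i) \<in> borel_measurable borel"
  by (intro borel_measurable_continuous_onI continuous_intros)

text \<open>Lower orthants generate the Borel sets and are stable under intersection, and on an
  orthant both measures are products of one-dimensional lengths. This expresses the product
  structure of the cube in a form that lets a single coordinate be integrated out without leaving
  \<open>real ^ 'n\<close>.\<close>

lemma distr_unit_cube_update:
  fixes j :: "'n::finite"
  shows "distr (unit_cube \<Otimes>\<^sub>M unit_interval) borel (\<lambda>(t, s). \<chi> i. if i = j then s else t $ i)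
    = (unit_cube :: (real ^ 'n) measure)" (is "distr _ _ ?u = _")
proof -
  interpret C: prob_space "unit_cube :: (real ^ 'n) measure" by (rule prob_space_unit_cube)
  interpret I: prob_space unit_interval by (rule prob_space_unit_interval)
  interpret CI: pair_prob_space "unit_cube :: (real ^ 'n) measure" unit_interval ..
  have [measurable]: "(\<lambda>(t, s). \<chi> i. if i = j then s else t $ i) \<in> borel_measurable (unit_cube \<Otimes>\<^sub>M unit_interval)"
    by (auto simp: case_prod_beta intro!: measurable_vec measurable_If)
  let ?E = "range (\<lambda>a::real ^ 'n. {..a})"
  have sigma: "sets borel = sigma_sets UNIV ?E"
    by (subst borel_eq_atMost) simp
  show ?thesis
  proof (rule measure_eqI_generator_eq[where E = ?E and \<Omega> = UNIV and A = "\<lambda>n. {..(\<chi> i. real n)}"])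
    show "Int_stable ?E"
    proof (rule Int_stableI, safe)
      fix a b :: "real ^ 'n"
      have "{..a} \<inter> {..b} = {..(\<chi> i. min (a $ i) (b $ i))}"
        by (auto simp: less_eq_vec_def)
      then show "{..a} \<inter> {..b} \<in> ?E" by blast
    qed
  next
    fix X assume "X \<in> ?E"
    then obtain a where X: "X = {..a}" by blast
    \<comment> \<open>Coordinate j of t is overwritten and hence unconstrained, so the preimage is a
      rectangle.\<close>
    have pre: "?u -` {..a} \<inter> space (unit_cube \<Otimes>\<^sub>M unit_interval) =
        {t. \<forall>i\<in>UNIV - {j}. t $ i \<le> a $ i} \<times> {..a $ j}"
      by (auto simp: less_eq_vec_def space_pair_measure split: if_splits)
    have "emeasure (distr (unit_cube \<Otimes>\<^sub>M unit_interval) borel ?u) X =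
        (\<Prod>i\<in>UNIV - {j}. ennreal (min 1 (a $ i))) * ennreal (min 1 (a $ j))"
      unfolding X by (subst emeasure_distr)
        (simp_all add: pre I.emeasure_pair_measure_Times emeasure_unit_cube_halfspaces
          emeasure_unit_interval_atMost)
    also have "\<dots> = (\<Prod>i\<in>UNIV. ennreal (min 1 (a $ i)))"
      by (subst prod.remove[of UNIV j]) (simp_all add: mult.commute)
    also have "\<dots> = emeasure unit_cube X"
      using emeasure_unit_cube_halfspaces[of UNIV a] by (simp add: X atMost_def less_eq_vec_def)
    finally show "emeasure (distr (unit_cube \<Otimes>\<^sub>M unit_interval) borel ?u) X = emeasure unit_cube X" .
  next
    show "(\<Union>n. {..(\<chi> i. real n)}) = (UNIV :: (real ^ 'n) set)"
    proof (intro equalityI subsetI UNIV_I)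
      fix x :: "real ^ 'n"
      obtain n where "norm x \<le> real n" using real_arch_simple by blast
      then have "x $ i \<le> real n" for i using component_le_norm_cart[of x i] by linarith
      then show "x \<in> (\<Union>n. {..(\<chi> i. real n)})" by (auto simp: less_eq_vec_def)
    qed
  next
    fix n :: nat
    interpret D: prob_space "distr (unit_cube \<Otimes>\<^sub>M unit_interval) borel ?u"
      by (rule CI.prob_space_distr) simp
    show "emeasure (distr (unit_cube \<Otimes>\<^sub>M unit_interval) borel ?u) {..(\<chi> i. real n)} \<noteq> \<infinity>"
      by simp
  qed (auto simp: sigma)
qed

lemma AE_unit_cube: "AE t in unit_cube. t \<in> cbox 0 (1 :: real ^ 'n)"
  unfolding unit_cube_def by (rule AE_uniform_measureI) simp_all

lemma integrable_unit_cube: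
  fixes G :: "real ^ 'n \<Rightarrow> 'b :: {banach, second_countable_topology}"
  assumes "continuous_on UNIV G"
  shows "integrable unit_cube G"
proof -
  interpret C: prob_space "unit_cube :: (real ^ 'n) measure" by (rule prob_space_unit_cube)
  have "bounded (G ` cbox 0 1)"
    by (intro compact_imp_bounded compact_continuous_image continuous_on_subset[OF assms]) auto
  then obtain B where "\<And>t. t \<in> cbox 0 1 \<Longrightarrow> norm (G t) \<le> B"
    by (auto simp: bounded_iff)
  then have "AE t in unit_cube. norm (G t) \<le> B"
    using AE_unit_cube by (auto elim!: eventually_mono)
  moreover have "G \<in> borel_measurable unit_cube"
    using borel_measurable_continuous_onI[OF assms] by simp
  ultimately show ?thesis by (intro C.integrable_const_bound) auto
qed

section \<open>Cauchy's formula on the torus\<close>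

lemma integral_unit_cube_update:
  fixes G :: "real ^ 'n \<Rightarrow> complex" and j :: 'n
  assumes "continuous_on UNIV G"
  shows "(\<integral>t. G t \<partial>unit_cube) =
    (\<integral>t. (\<integral>s. G (\<chi> i. if i = j then s else t $ i) \<partial>unit_interval) \<partial>unit_cube)"
proof -
  interpret C: prob_space "unit_cube :: (real ^ 'n) measure" by (rule prob_space_unit_cube)
  interpret I: prob_space unit_interval by (rule prob_space_unit_interval)
  interpret CI: pair_prob_space "unit_cube :: (real ^ 'n) measure" unit_interval ..
  let ?u = "\<lambda>(t :: real ^ 'n, s). \<chi> i. if i = j then s else t $ i"
  have [measurable]: "?u \<in> borel_measurable (unit_cube \<Otimes>\<^sub>M unit_interval)"
    by (auto simp: case_prod_beta intro!: measurable_vec measurable_If)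
  have [measurable]: "G \<in> borel_measurable borel"
    using assms by (rule borel_measurable_continuous_onI)
  have "integrable (distr (unit_cube \<Otimes>\<^sub>M unit_interval) borel ?u) G"
    by (simp add: distr_unit_cube_update integrable_unit_cube[OF assms])
  then have int: "integrable (unit_cube \<Otimes>\<^sub>M unit_interval) (\<lambda>x. G (?u x))"
    by (rule integrable_distr[rotated]) simp
  have "(\<integral>t. G t \<partial>unit_cube) = integral\<^sup>L (distr (unit_cube \<Otimes>\<^sub>M unit_interval) borel ?u) G"
    by (simp add: distr_unit_cube_update)
  also have "\<dots> = (\<integral>x. G (?u x) \<partial>(unit_cube \<Otimes>\<^sub>M unit_interval))"
    by (rule integral_distr) simp_all
  also have "\<dots> = (\<integral>t. (\<integral>s. G (?u (t, s)) \<partial>unit_interval) \<partial>unit_cube)"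
    by (rule CI.integral_fst'[symmetric, OF int])
  finally show ?thesis by simp
qed

text \<open>On the unit circle the conjugate of zeta is its inverse, so d zeta / (zeta - w) equals 2
  pi i ds / (1 - w cnj zeta): this is Cauchy's formula with the Szego kernel in place of the Cauchy
  kernel. The assumption \<open>1 < R\<close> puts the closed disc inside the domain of g.\<close>

lemma circle_Cauchy:
  assumes g: "g holomorphic_on ball 0 R" and R: "1 < R" and w: "norm w < 1"
  shows "(\<integral>s. g (cis (2 * pi * s)) / (1 - w * cnj (cis (2 * pi * s))) \<partial>unit_interval) = g w"
proof -
  let ?F = "\<lambda>s. g (cis (2 * pi * s)) / (1 - w * cnj (cis (2 * pi * s)))"
  have nz: "1 - w * cnj (cis x) \<noteq> 0" for x
  proof
    assume "1 - w * cnj (cis x) = 0"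
    then have "norm (w * cnj (cis x)) = 1" by simp
    then show False using w by (simp add: norm_mult)
  qed
  have cont: "continuous_on UNIV ?F"
  proof (intro continuous_intros)
    show "continuous_on UNIV (\<lambda>s. g (cis (2 * pi * s)))"
      using R by (intro continuous_on_compose2[OF holomorphic_on_imp_continuous_on[OF g]] continuous_intros) auto
  qed (use nz in auto)
  then have meas: "?F \<in> borel_measurable borel"
    by (rule borel_measurable_continuous_onI)
  have "((\<lambda>z. g z / (z - w)) has_contour_integral 2 * of_real pi * \<i> * g w) (circlepath 0 1)"
    using R w by (intro Cauchy_integral_circlepath_simple holomorphic_on_subset[OF g]) auto
  then have "((\<lambda>s. g (circlepath 0 1 s) / (circlepath 0 1 s - w) *
      vector_derivative (circlepath 0 1) (at s within {0..1})) has_integral 2 * of_real pi * \<i> * g w) {0..1}"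
    by (simp add: has_contour_integral_def)
  then have "((\<lambda>s. 2 * of_real pi * \<i> * ?F s) has_integral 2 * of_real pi * \<i> * g w) {0..1}"
  proof (rule has_integral_eq[rotated])
    fix s :: real assume s: "s \<in> {0..1}"
    define e where "e = cis (2 * pi * s)"
    have c: "circlepath 0 1 s = e" "exp (2 * of_real pi * \<i> * s) = e"
      by (simp_all add: circlepath cis_conv_exp mult_ac e_def)
    have v: "vector_derivative (circlepath 0 1) (at s within {0..1}) = 2 * of_real pi * \<i> * e"
      using s by (simp add: vector_derivative_circlepath01 c)
    have "e * cnj e = 1" by (simp add: e_def cis_cnj cis_mult)
    then have "e - w = e * (1 - w * cnj e)" by (simp add: algebra_simps)
    moreover have "1 - w * cnj e \<noteq> 0" "e \<noteq> 0" using nz[of "2 * pi * s"] by (auto simp: e_def)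
    ultimately have "g e / (e - w) * (2 * of_real pi * \<i> * e) = 2 * of_real pi * \<i> * (g e / (1 - w * cnj e))"
      by simp
    then show "g (circlepath 0 1 s) / (circlepath 0 1 s - w) *
      vector_derivative (circlepath 0 1) (at s within {0..1}) = 2 * of_real pi * \<i> * ?F s"
      unfolding c v by (simp add: e_def)
  qed
  then have "((\<lambda>s. 1 / (2 * of_real pi * \<i>) * (2 * of_real pi * \<i> * ?F s)) has_integral
      1 / (2 * of_real pi * \<i>) * (2 * of_real pi * \<i> * g w)) {0..1}"
    by (rule has_integral_mult_right)
  then have "(?F has_integral g w) {0..1}"
    by simp
  then have "integral {0..1} ?F = g w" by (rule integral_unique)
  moreover have "(\<integral>s. ?F s \<partial>unit_interval) = integral {0..1} ?F"
  proof -
    have "unit_interval = density lborel (\<lambda>s. ennreal (indicator {0..1} s))"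
      by (simp add: unit_interval_def uniform_measure_def divide_ennreal_def ennreal_indicator)
    moreover have "integral\<^sup>L (density lborel (\<lambda>s. ennreal (indicator {0..1} s))) ?F =
        (\<integral>s. indicator {0..1} s *\<^sub>R ?F s \<partial>lborel)"
      by (rule integral_density) (use meas in auto)
    ultimately have "(\<integral>s. ?F s \<partial>unit_interval) = (LINT s:{0..1}|lborel. ?F s)"
      by (simp only: set_lebesgue_integral_def)
    also have "\<dots> = integral {0..1} ?F"
      by (intro set_borel_integral_eq_integral borel_integrable_atLeastAtMost' continuous_on_subset[OF cont]) auto
    finally show ?thesis .
  qed
  ultimately show ?thesis by simp
qed

section \<open>Holomorphic functions on the polydisc and the several-variable Cauchy formula\<close>

lemma open_polydisc [simp]: "open (polydisc :: (complex ^ 'n) set)"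
proof -
  have "polydisc = (\<Inter>i. {z :: complex ^ 'n. norm (z $ i) < 1})"
    by (auto simp: polydisc_def)
  moreover have "open (\<Inter>i. {z :: complex ^ 'n. norm (z $ i) < 1})"
    by (intro open_INT ballI finite open_Collect_less continuous_intros)
  ultimately show ?thesis by simp
qed

lemma holomorphic_vec_on_imp_continuous_on:
  "f holomorphic_vec_on S \<Longrightarrow> continuous_on S f"
  unfolding holomorphic_vec_on_def continuous_on_eq_continuous_within
  by (meson has_derivative_continuous)

lemma holomorphic_vec_on_polydisc_iff:
  "f holomorphic_vec_on polydisc \<longleftrightarrow>
    (\<forall>z\<in>polydisc. \<exists>L. (f has_derivative L) (at z) \<and> (\<forall>c x. L (c *s x) = c * L x))"
  by (auto simp: holomorphic_vec_on_def at_within_open[OF _ open_polydisc])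

lemma holomorphic_vec_onE:
  assumes "f holomorphic_vec_on polydisc" "z \<in> polydisc"
  obtains L where "(f has_derivative L) (at z)" "\<And>c x. L (c *s x) = c * L x"
  using assms unfolding holomorphic_vec_on_polydisc_iff by blast

text \<open>By complex linearity the Frechet derivative along the line is multiplication by
  \<open>L q\<close>, hence a complex derivative. This gives access to the one-variable theory in
  each coordinate.\<close>

lemma holomorphic_vec_on_line:
  fixes f :: "complex ^ 'n \<Rightarrow> complex"
  assumes f: "f holomorphic_vec_on polydisc" and U: "open U"
    and pq: "\<And>x. x \<in> U \<Longrightarrow> p + x *s q \<in> polydisc"
  shows "(\<lambda>x. f (p + x *s q)) holomorphic_on U"
proof (rule holomorphic_onI)
  fix x assume x: "x \<in> U"
  obtain L where L: "(f has_derivative L) (at (p + x *s q))" "\<And>c y. L (c *s y) = c * L y"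
    using holomorphic_vec_onE[OF f pq[OF x]] by blast
  have "bounded_linear (\<lambda>x. x *s q)"
  proof (intro linear_conv_bounded_linear[THEN iffD1] linearI)
    show "(a + b) *s q = a *s q + b *s q" for a b
      by (simp add: vec_eq_iff algebra_simps)
    show "(r *\<^sub>R b) *s q = r *\<^sub>R (b *s q)" for r :: real and b
      by (simp add: vec_eq_iff)
  qed
  then have "((\<lambda>x. p + x *s q) has_derivative (\<lambda>x. x *s q)) (at x)"
    by (auto intro!: derivative_eq_intros bounded_linear_imp_has_derivative)
  from has_derivative_compose[OF this L(1)]
  have "((\<lambda>x. f (p + x *s q)) has_field_derivative L q) (at x)"
    by (simp add: L(2) has_field_derivative_def mult_commute_abs)
  then show "(\<lambda>x. f (p + x *s q)) field_differentiable (at x within U)"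
    by (auto simp: field_differentiable_def intro: has_field_derivative_at_within)
qed

lemma torus_point_nth [simp]: "torus_point t $ i = cis (2 * pi * t $ i)"
  by (simp add: torus_point_def)

lemma one_minus_mult_neq_0:
  fixes w z :: complex
  assumes "norm w < 1" "norm z \<le> 1"
  shows "1 - w * z \<noteq> 0"
proof
  assume "1 - w * z = 0"
  then have "norm (w * z) = 1" by simp
  moreover have "norm (w * z) \<le> norm w * 1"
    using assms by (simp add: norm_mult mult_left_mono del: mult_1_right)
  ultimately show False using assms by simp
qed

text \<open>F is holomorphic only on the open polydisc, hence the radius r below 1. Cauchy's formula
  in coordinate j consumes the j-th kernel factor and replaces the j-th argument by
  \<open>w $ j\<close>; doing this for every coordinate leaves a constant.\<close>

lemma torus_Cauchy:
  fixes F :: "complex ^ 'n \<Rightarrow> complex"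
  assumes F: "F holomorphic_vec_on polydisc" and r: "0 < r" "r < 1" and w: "w \<in> polydisc"
  shows "torus_mean (\<lambda>\<zeta>. F (r *\<^sub>R \<zeta>) * (\<Prod>i\<in>UNIV. 1 / (1 - w $ i * cnj (\<zeta> $ i)))) = F (r *\<^sub>R w)"
proof -
  (* G S is the integrand once the coordinates in S have been integrated out *)
  define mix where "mix S t = (\<chi> i. if i \<in> S then w $ i else cis (2 * pi * t $ i))" for S and t :: "real ^ 'n"
  define k where "k i s = 1 / (1 - w $ i * cnj (cis (2 * pi * s)))" for i and s :: real
  define G where "G S t = F (r *\<^sub>R mix S t) * (\<Prod>i\<in>UNIV - S. k i (t $ i))" for S t
  have w1: "norm (w $ i) < 1" for i using w by (simp add: polydisc_def)
  have contk: "continuous_on UNIV (k i)" for i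
    unfolding k_def by (intro continuous_intros) (use one_minus_mult_neq_0[OF w1] in auto)
  have mix_in: "r *\<^sub>R mix S t \<in> polydisc" for S t
  proof -
    have "norm (mix S t $ i) \<le> 1" for i
      using w1[of i] by (simp add: mix_def)
    then have "r * norm (mix S t $ i) \<le> r * 1" for i
      using r by (intro mult_left_mono) auto
    then have "r * norm (mix S t $ i) < 1" for i
      using r by (simp add: le_less_trans[of _ r 1])
    then show ?thesis using r by (simp add: polydisc_def)
  qed
  have cont: "continuous_on UNIV (G S)" for S
    unfolding G_def
  proof (intro continuous_intros)
    show "continuous_on UNIV (\<lambda>t. F (r *\<^sub>R mix S t))"
    proof (rule continuous_on_compose2[OF holomorphic_vec_on_imp_continuous_on[OF F]])
      show "continuous_on UNIV (\<lambda>t. r *\<^sub>R mix S t)"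
        unfolding mix_def
      proof (intro continuous_intros)
        show "continuous_on UNIV (\<lambda>t. if i \<in> S then w $ i else cis (2 * pi * t $ i))" for i
          by (cases "i \<in> S") (auto intro!: continuous_intros)
      qed
    qed (use mix_in in auto)
    show "continuous_on UNIV (\<lambda>t. k i (t $ i))" for i
      by (rule continuous_on_compose2[OF contk]) (auto intro!: continuous_intros)
  qed
  have step: "(\<integral>s. G S (\<chi> i. if i = j then s else t $ i) \<partial>unit_interval) = G (insert j S) t"
    if j: "j \<notin> S" for j S t
  proof -
    \<comment> \<open>As x varies, \<open>p + x *s q\<close> moves only coordinate j, whose value is
      r x; the other coordinates are frozen.\<close>
    define p where "p = r *\<^sub>R (\<chi> i. if i = j then 0 else mix S t $ i)"
    define q where "q = (\<chi> i. if i = j then complex_of_real r else 0)"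
    define A where "A = (\<Prod>i\<in>UNIV - insert j S. k i (t $ i))"
    let ?g = "\<lambda>x. F (p + x *s q) * A"
    \<comment> \<open>Since r is below 1, the radius 1/r exceeds 1, as \<open>circle_Cauchy\<close>
      demands.\<close>
    have "?g holomorphic_on ball 0 (1 / r)"
    proof (intro holomorphic_intros holomorphic_vec_on_line[OF F])
      fix x :: complex assume "x \<in> ball 0 (1 / r)"
      then have "norm x * r < 1" using r by (simp add: field_simps)
      moreover have "norm ((r *\<^sub>R mix S t) $ i) < 1" for i
        using mix_in[of S t] unfolding polydisc_def by blast
      ultimately show "p + x *s q \<in> polydisc"
        using r by (auto simp: polydisc_def p_def q_def norm_mult)
    qed auto
    then have circ: "(\<integral>s. ?g (cis (2 * pi * s)) / (1 - w $ j * cnj (cis (2 * pi * s))) \<partial>unit_interval) = ?g (w $ j)"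
      using r w1 by (intro circle_Cauchy[where R = "1 / r"]) auto
    have fin: "p + (w $ j) *s q = r *\<^sub>R mix (insert j S) t"
      using j by (auto simp: vec_eq_iff p_def q_def mix_def scaleR_conv_of_real[where 'a = complex])
    have "G S (\<chi> i. if i = j then s else t $ i) =
        ?g (cis (2 * pi * s)) / (1 - w $ j * cnj (cis (2 * pi * s)))" for s
    proof -
      have "p + cis (2 * pi * s) *s q = r *\<^sub>R mix S (\<chi> i. if i = j then s else t $ i)"
        using j by (auto simp: vec_eq_iff p_def q_def mix_def scaleR_conv_of_real[where 'a = complex])
      moreover have "(\<Prod>i\<in>UNIV - S. k i ((\<chi> i. if i = j then s else t $ i) $ i)) = k j s * A"
      proof -
        have "UNIV - S = insert j (UNIV - insert j S)" using j by auto
        moreover have "(\<Prod>i\<in>UNIV - insert j S. k i ((\<chi> i. if i = j then s else t $ i) $ i)) = A"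
          unfolding A_def by (rule prod.cong) auto
        ultimately show ?thesis by simp
      qed
      ultimately show ?thesis by (simp add: G_def k_def)
    qed
    then have "(\<integral>s. G S (\<chi> i. if i = j then s else t $ i) \<partial>unit_interval) = ?g (w $ j)"
      by (simp only: circ)
    then show ?thesis by (simp add: G_def A_def fin)
  qed
  \<comment> \<open>At S = {} this is the torus mean in question; at S = UNIV the integrand no
    longer depends on t.\<close>
  have "(\<integral>t. G {} t \<partial>unit_cube) = (\<integral>t. G S t \<partial>unit_cube)" for S :: "'n set"
  proof (induction S rule: finite_induct[OF finite])
    case (2 j S)
    then show ?case
      using integral_unit_cube_update[OF cont[of S], of j] by (simp add: step)
  qed auto
  also have "(\<integral>t. G UNIV t \<partial>unit_cube) = F (r *\<^sub>R w)"
    using prob_space.prob_space[OF prob_space_unit_cube[where 'n = 'n]] by (simp add: G_def mix_def)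
  finally show ?thesis
    by (simp add: torus_mean_def G_def mix_def k_def torus_point_def)
qed

section \<open>The bilinear torus pairing\<close>

lemma Fubini_unit_cube:
  fixes G :: "real ^ 'n \<Rightarrow> real ^ 'n \<Rightarrow> complex"
  assumes cont: "continuous_on UNIV (\<lambda>(x, y). G x y)"
  shows "(\<integral>x. (\<integral>y. G x y \<partial>unit_cube) \<partial>unit_cube) = (\<integral>y. (\<integral>x. G x y \<partial>unit_cube) \<partial>unit_cube)"
proof -
  interpret C: prob_space "unit_cube :: (real ^ 'n) measure" by (rule prob_space_unit_cube)
  interpret P: pair_prob_space "unit_cube :: (real ^ 'n) measure" "unit_cube :: (real ^ 'n) measure" ..
  let ?P = "unit_cube \<Otimes>\<^sub>M (unit_cube :: (real ^ 'n) measure)"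
  let ?Q = "cbox 0 (1 :: real ^ 'n)"
  have meas: "(\<lambda>(x, y). G x y) \<in> borel_measurable ?P"
    using borel_measurable_continuous_onI[OF cont]
    by (simp add: borel_prod[symmetric] cong: measurable_cong_sets sets_pair_measure_cong)
  have "bounded ((\<lambda>(x, y). G x y) ` (?Q \<times> ?Q))"
    by (intro compact_imp_bounded compact_continuous_image continuous_on_subset[OF cont] compact_Times) auto
  then obtain B where B: "\<And>x y. x \<in> ?Q \<Longrightarrow> y \<in> ?Q \<Longrightarrow> norm (G x y) \<le> B"
    by (force simp: bounded_iff)
  have Q: "?Q \<in> sets unit_cube" by simp
  have "AE z in ?P. z \<in> ?Q \<times> ?Q"
  proof (rule P.AE_pair_measure)
    show "{z \<in> space ?P. z \<in> ?Q \<times> ?Q} \<in> sets ?P"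
      using pair_measureI[OF Q Q] by (simp add: space_pair_measure)
    show "AE x in unit_cube. AE y in unit_cube. (x, y) \<in> ?Q \<times> ?Q"
      using AE_unit_cube by (auto elim!: eventually_mono)
  qed
  then have "AE z in ?P. norm ((\<lambda>(x, y). G x y) z) \<le> B"
    by (rule eventually_mono) (use B in auto)
  then have "integrable ?P (\<lambda>(x, y). G x y)"
    using meas by (rule P.P.integrable_const_bound)
  then show ?thesis by (rule P.Fubini_integral[symmetric])
qed

section \<open>Coordinatewise conjugation and the conjugation J\<close>

definition vcnj :: "complex ^ 'n \<Rightarrow> complex ^ 'n" where
  "vcnj z = (\<chi> i. cnj (z $ i))"

lemma vcnj_nth [simp]: "vcnj z $ i = cnj (z $ i)"
  by (simp add: vcnj_def)

lemma vcnj_vcnj [simp]: "vcnj (vcnj z) = z"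
  by (simp add: vec_eq_iff)

lemma vcnj_scaleR: "vcnj (r *\<^sub>R z) = r *\<^sub>R vcnj z"
  by (simp add: vec_eq_iff)

lemma vcnj_in_polydisc [simp]: "vcnj z \<in> polydisc \<longleftrightarrow> z \<in> polydisc"
  by (simp add: polydisc_def)

lemma bounded_linear_vcnj: "bounded_linear (vcnj :: complex ^ 'n \<Rightarrow> complex ^ 'n)"
  unfolding linear_conv_bounded_linear[symmetric]
  by (rule linearI) (simp_all add: vec_eq_iff)

lemmas continuous_on_vcnj [continuous_intros] =
  bounded_linear.continuous_on[OF bounded_linear_vcnj]

lemma standard_conjugation_vcnj: "standard_conjugation f z = cnj (f (vcnj z))"
  by (simp add: standard_conjugation_def vcnj_def)

lemma standard_conjugation_twice [simp]: "standard_conjugation (standard_conjugation f) = f"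
  by (simp add: standard_conjugation_vcnj fun_eq_iff)

text \<open>The two conjugations cancel: conjugating L in its argument and in its value gives a
  complex-linear derivative again.\<close>

lemma holomorphic_vec_on_standard_conjugation:
  fixes f :: "complex ^ 'n \<Rightarrow> complex"
  assumes "f holomorphic_vec_on polydisc"
  shows "standard_conjugation f holomorphic_vec_on polydisc"
  unfolding holomorphic_vec_on_polydisc_iff
proof
  fix z :: "complex ^ 'n" assume z: "z \<in> polydisc"
  then have "vcnj z \<in> polydisc" by simp
  with assms obtain L where L: "(f has_derivative L) (at (vcnj z))" "\<And>c y. L (c *s y) = c * L y"
    using holomorphic_vec_onE by blast
  have "((\<lambda>z. cnj (f (vcnj z))) has_derivative (\<lambda>x. cnj (L (vcnj x)))) (at z)"
    by (intro bounded_linear.has_derivative[OF bounded_linear_cnj]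
        has_derivative_compose[OF bounded_linear_imp_has_derivative[OF bounded_linear_vcnj] L(1)])
  moreover have "vcnj (c *s x) = cnj c *s vcnj x" for c and x :: "complex ^ 'n"
    by (simp add: vec_eq_iff)
  ultimately show "\<exists>L. (standard_conjugation f has_derivative L) (at z) \<and> (\<forall>c x. L (c *s x) = c * L x)"
    unfolding standard_conjugation_vcnj[abs_def]
    by (auto intro!: exI[of _ "\<lambda>x. cnj (L (vcnj x))"] simp: L(2))
qed

lemma continuous_on_torus_point [continuous_intros]:
  "continuous_on S g \<Longrightarrow> continuous_on S (\<lambda>x. torus_point (g x))"
  unfolding torus_point_def by (intro continuous_intros)

lemma torus_point_scaled_in_polydisc [simp]:
  "\<bar>r\<bar> < 1 \<Longrightarrow> r *\<^sub>R torus_point t \<in> polydisc"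
  by (simp add: polydisc_def)

lemma torus_point_conj_scaled_in_polydisc [simp]:
  "\<bar>r\<bar> < 1 \<Longrightarrow> r *\<^sub>R vcnj (torus_point t) \<in> polydisc"
  by (simp add: polydisc_def)

lemma continuous_on_holomorphic_vec [continuous_intros]:
  assumes "A holomorphic_vec_on polydisc" "continuous_on S p" "\<And>x. x \<in> S \<Longrightarrow> p x \<in> polydisc"
  shows "continuous_on S (\<lambda>x. A (p x))"
  using assms(2,3) by (intro continuous_on_compose2[OF holomorphic_vec_on_imp_continuous_on[OF assms(1)]]) auto

text \<open>With Taylor coefficients a_m and b_m this is the sum of a_m b_m (r t)^|m|, which
  explains its symmetry and its dependence on r t alone. Conjugating the argument of B instead of
  its value keeps the form bilinear in holomorphic functions.\<close>

definition torus_pairing ::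
    "(complex ^ 'n \<Rightarrow> complex) \<Rightarrow> (complex ^ 'n \<Rightarrow> complex) \<Rightarrow> real \<Rightarrow> real \<Rightarrow> complex" where
  "torus_pairing A B r t = torus_mean (\<lambda>\<zeta>. A (r *\<^sub>R \<zeta>) * B (t *\<^sub>R vcnj \<zeta>))"

text \<open>Cauchy's formula at radius \<rho> expresses B at t conj(x) as a mean of B(\<rho> y)
  against the kernel at q conj(x), where q = t/\<rho>. That kernel is symmetric in x and y, so after
  exchanging the integrals the same kernel evaluates A at r q conj(y). The assumption
  \<open>t < \<rho>\<close> ensures q < 1.\<close>

lemma torus_pairing_swap:
  fixes A B :: "complex ^ 'n \<Rightarrow> complex"
  assumes A: "A holomorphic_vec_on polydisc" and B: "B holomorphic_vec_on polydisc"
    and r: "0 < r" "r < 1" and t: "0 < t" "t < \<rho>" and \<rho>: "\<rho> < 1"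
  shows "torus_pairing A B r t = torus_pairing B A \<rho> (r * t / \<rho>)"
proof -
  define q where "q = t / \<rho>"
  have q: "0 < q" "q < 1" "t = \<rho> * q" "r * t / \<rho> = r * q" using t by (auto simp: q_def)
  define K where "K x y = (\<Prod>i\<in>UNIV. 1 / (1 - (q *\<^sub>R vcnj (torus_point x)) $ i * cnj (torus_point y $ i)))"
    for x y :: "real ^ 'n"
  have nz: "1 - (q *\<^sub>R vcnj (torus_point x)) $ i * cnj (torus_point y $ i) \<noteq> 0" for x y :: "real ^ 'n" and i
    by (rule one_minus_mult_neq_0) (use q in simp_all)
  have K_sym: "K x y = K y x" for x y
    unfolding K_def by (intro prod.cong) (auto simp: mult_ac)
  have "torus_pairing A B r t = (\<integral>x. A (r *\<^sub>R torus_point x) * (\<integral>y. B (\<rho> *\<^sub>R torus_point y) * K x y \<partial>unit_cube) \<partial>unit_cube)"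
    unfolding torus_pairing_def torus_mean_def
  proof (intro Bochner_Integration.integral_cong refl)
    fix x :: "real ^ 'n"
    have "(\<integral>y. B (\<rho> *\<^sub>R torus_point y) * K x y \<partial>unit_cube) = B (\<rho> *\<^sub>R (q *\<^sub>R vcnj (torus_point x)))"
      using torus_Cauchy[OF B, of \<rho> "q *\<^sub>R vcnj (torus_point x)"] t \<rho> q by (simp add: torus_mean_def K_def)
    then show "A (r *\<^sub>R torus_point x) * B (t *\<^sub>R vcnj (torus_point x)) =
        A (r *\<^sub>R torus_point x) * (\<integral>y. B (\<rho> *\<^sub>R torus_point y) * K x y \<partial>unit_cube)"
      by (simp add: q)
  qed
  also have "\<dots> = (\<integral>x. (\<integral>y. A (r *\<^sub>R torus_point x) * (B (\<rho> *\<^sub>R torus_point y) * K x y) \<partial>unit_cube) \<partial>unit_cube)"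
    by simp
  also have "\<dots> = (\<integral>y. (\<integral>x. A (r *\<^sub>R torus_point x) * (B (\<rho> *\<^sub>R torus_point y) * K x y) \<partial>unit_cube) \<partial>unit_cube)"
    unfolding K_def
    by (intro Fubini_unit_cube, unfold case_prod_beta)
       (intro continuous_intros A B nz ballI; use r t \<rho> in simp)
  also have "\<dots> = (\<integral>y. B (\<rho> *\<^sub>R torus_point y) * (\<integral>x. A (r *\<^sub>R torus_point x) * K y x \<partial>unit_cube) \<partial>unit_cube)"
    by (simp add: mult_ac K_sym flip: integral_mult_right_zero)
  also have "\<dots> = torus_pairing B A \<rho> (r * t / \<rho>)"
    unfolding torus_pairing_def torus_mean_def
  proof (intro Bochner_Integration.integral_cong refl)
    fix y :: "real ^ 'n"
    have "(\<integral>x. A (r *\<^sub>R torus_point x) * K y x \<partial>unit_cube) = A (r *\<^sub>R (q *\<^sub>R vcnj (torus_point y)))"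
      using torus_Cauchy[OF A, of r "q *\<^sub>R vcnj (torus_point y)"] r q by (simp add: torus_mean_def K_def)
    then show "B (\<rho> *\<^sub>R torus_point y) * (\<integral>x. A (r *\<^sub>R torus_point x) * K y x \<partial>unit_cube) =
        B (\<rho> *\<^sub>R torus_point y) * A ((r * t / \<rho>) *\<^sub>R vcnj (torus_point y))"
      unfolding q(4) by simp
  qed
  finally show ?thesis .
qed

text \<open>Two swaps: exchange A and B through an auxiliary radius \<sigma>, then exchange them
  back with r' as the outer radius. The first requires t < \<sigma>; the second requires r t /
  \<sigma> < r', which amounts to t' < \<sigma> because the products agree.\<close>

lemma torus_pairing_cong:
  fixes A B :: "complex ^ 'n \<Rightarrow> complex"
  assumes A: "A holomorphic_vec_on polydisc" and B: "B holomorphic_vec_on polydisc"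
    and r: "0 < r" "r < 1" "0 < t" "t < 1" and r': "0 < r'" "r' < 1" "0 < t'" "t' < 1"
    and eq: "r * t = r' * t'"
  shows "torus_pairing A B r t = torus_pairing A B r' t'"
proof -
  obtain \<sigma> where s: "max t t' < \<sigma>" "\<sigma> < 1" using dense[of "max t t'" 1] r r' by auto
  then have s0: "0 < \<sigma>" using r by simp
  have "r * t / \<sigma> < r'" using s r' s0 by (simp add: eq divide_less_eq)
  moreover have "0 < r * t / \<sigma>" using r s0 by simp
  moreover have "\<sigma> * (r * t / \<sigma>) / r' = t'" using s0 r' eq by simp
  ultimately have "torus_pairing B A \<sigma> (r * t / \<sigma>) = torus_pairing A B r' t'"
    using torus_pairing_swap[OF B A, of \<sigma> "r * t / \<sigma>" r'] s s0 r' by simp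
  then show ?thesis
    using torus_pairing_swap[OF A B, of r t \<sigma>] s r by simp
qed

lemma torus_pairing_sym:
  fixes A B :: "complex ^ 'n \<Rightarrow> complex"
  assumes A: "A holomorphic_vec_on polydisc" and B: "B holomorphic_vec_on polydisc"
    and r: "0 < r" "r < 1"
  shows "torus_pairing A B r r = torus_pairing B A r r"
proof -
  obtain \<sigma> where s: "r < \<sigma>" "\<sigma> < 1" using dense[of r 1] r by auto
  have "r * r / \<sigma> < 1"
    using s r mult_strict_mono[of r \<sigma> r 1] by (simp add: divide_less_eq)
  then have "torus_pairing B A \<sigma> (r * r / \<sigma>) = torus_pairing B A r r"
    using s r by (intro torus_pairing_cong[OF B A]) auto
  then show ?thesis
    using torus_pairing_swap[OF A B, of r r \<sigma>] s r by simp
qed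

section \<open>Mean squares on tori\<close>

lemma holomorphic_vec_on_const: "(\<lambda>_. c) holomorphic_vec_on polydisc"
  unfolding holomorphic_vec_on_polydisc_iff by (auto intro!: exI[of _ "\<lambda>_. 0"])

lemma holomorphic_vec_on_nth: "(\<lambda>z. z $ i) holomorphic_vec_on polydisc"
  unfolding holomorphic_vec_on_polydisc_iff
  by (auto intro!: exI[of _ "\<lambda>z. z $ i"] bounded_linear_imp_has_derivative bounded_linear_vec_nth)

lemma holomorphic_vec_on_add:
  assumes f: "f holomorphic_vec_on polydisc" and g: "g holomorphic_vec_on polydisc"
  shows "(\<lambda>z. f z + g z) holomorphic_vec_on polydisc"
  unfolding holomorphic_vec_on_polydisc_iff
proof
  fix z :: "complex ^ 'a" assume z: "z \<in> polydisc"
  obtain L where L: "(f has_derivative L) (at z)" "\<And>c x. L (c *s x) = c * L x"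
    using holomorphic_vec_onE[OF f z] by blast
  obtain M where M: "(g has_derivative M) (at z)" "\<And>c x. M (c *s x) = c * M x"
    using holomorphic_vec_onE[OF g z] by blast
  show "\<exists>L. ((\<lambda>z. f z + g z) has_derivative L) (at z) \<and> (\<forall>c x. L (c *s x) = c * L x)"
    using has_derivative_add[OF L(1) M(1)]
    by (auto intro!: exI[of _ "\<lambda>x. L x + M x"] simp: L(2) M(2) algebra_simps)
qed

lemma holomorphic_vec_on_mult:
  assumes f: "f holomorphic_vec_on polydisc" and g: "g holomorphic_vec_on polydisc"
  shows "(\<lambda>z. f z * g z) holomorphic_vec_on polydisc"
  unfolding holomorphic_vec_on_polydisc_iff
proof
  fix z :: "complex ^ 'a" assume z: "z \<in> polydisc"
  obtain L where L: "(f has_derivative L) (at z)" "\<And>c x. L (c *s x) = c * L x"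
    using holomorphic_vec_onE[OF f z] by blast
  obtain M where M: "(g has_derivative M) (at z)" "\<And>c x. M (c *s x) = c * M x"
    using holomorphic_vec_onE[OF g z] by blast
  show "\<exists>L. ((\<lambda>z. f z * g z) has_derivative L) (at z) \<and> (\<forall>c x. L (c *s x) = c * L x)"
    using has_derivative_mult[OF L(1) M(1)]
    by (auto intro!: exI[of _ "\<lambda>x. f z * M x + L x * g z"] simp: L(2) M(2) algebra_simps)
qed

lemma holomorphic_vec_on_prod:
  assumes "\<And>i. i \<in> I \<Longrightarrow> f i holomorphic_vec_on polydisc"
  shows "(\<lambda>z. \<Prod>i\<in>I. f i z) holomorphic_vec_on polydisc"
  using assms
  by (induction I rule: infinite_finite_induct)
     (auto intro: holomorphic_vec_on_mult holomorphic_vec_on_const)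

lemma holomorphic_vec_on_compose:
  assumes f: "f holomorphic_vec_on polydisc" and g: "g holomorphic_on U" "open U"
    and U: "\<And>z. z \<in> polydisc \<Longrightarrow> f z \<in> U"
  shows "(\<lambda>z. g (f z)) holomorphic_vec_on polydisc"
  unfolding holomorphic_vec_on_polydisc_iff
proof
  fix z :: "complex ^ 'a" assume z: "z \<in> polydisc"
  obtain L where L: "(f has_derivative L) (at z)" "\<And>c x. L (c *s x) = c * L x"
    using holomorphic_vec_onE[OF f z] by blast
  have "(g has_derivative (\<lambda>x. deriv g (f z) * x)) (at (f z))"
    using holomorphic_derivI[OF g U[OF z]] by (simp add: has_field_derivative_def)
  from has_derivative_compose[OF L(1) this]
  show "\<exists>L. ((\<lambda>z. g (f z)) has_derivative L) (at z) \<and> (\<forall>c x. L (c *s x) = c * L x)"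
    by (auto intro!: exI[of _ "\<lambda>x. deriv g (f z) * L x"] simp: L(2))
qed

lemma holomorphic_vec_on_cong:
  assumes f: "f holomorphic_vec_on polydisc" and eq: "\<And>z. z \<in> polydisc \<Longrightarrow> f z = g z"
  shows "g holomorphic_vec_on polydisc"
  unfolding holomorphic_vec_on_polydisc_iff
proof
  fix z :: "complex ^ 'a" assume z: "z \<in> polydisc"
  obtain L where L: "(f has_derivative L) (at z)" "\<And>c x. L (c *s x) = c * L x"
    using holomorphic_vec_onE[OF f z] by blast
  have "(g has_derivative L) (at z)"
    using has_derivative_transform_within_open[OF L(1) open_polydisc z eq] .
  then show "\<exists>L. (g has_derivative L) (at z) \<and> (\<forall>c x. L (c *s x) = c * L x)"
    using L(2) by blast
qed

lemma polydisc_scaleR: "\<bar>r\<bar> \<le> 1 \<Longrightarrow> z \<in> polydisc \<Longrightarrow> r *\<^sub>R z \<in> polydisc"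
  unfolding polydisc_def by (auto intro: le_less_trans[OF mult_left_le_one_le])

lemma holomorphic_vec_on_dilate:
  fixes f :: "complex ^ 'n \<Rightarrow> complex"
  assumes f: "f holomorphic_vec_on polydisc" and r: "\<bar>r\<bar> \<le> 1"
  shows "(\<lambda>z. f (r *\<^sub>R z)) holomorphic_vec_on polydisc"
  unfolding holomorphic_vec_on_polydisc_iff
proof
  fix z :: "complex ^ 'n" assume z: "z \<in> polydisc"
  obtain L where L: "(f has_derivative L) (at (r *\<^sub>R z))" "\<And>c x. L (c *s x) = c * L x"
    using holomorphic_vec_onE[OF f polydisc_scaleR[OF r z]] by blast
  have "((\<lambda>z. r *\<^sub>R z) has_derivative (\<lambda>x. r *\<^sub>R x)) (at z)"
    by (auto intro!: derivative_eq_intros)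
  from has_derivative_compose[OF this L(1)]
  have "((\<lambda>z. f (r *\<^sub>R z)) has_derivative (\<lambda>x. L (r *\<^sub>R x))) (at z)" .
  moreover have "r *\<^sub>R (c *s x) = c *s (r *\<^sub>R x)" for c and x :: "complex ^ 'n"
    by (simp add: vec_eq_iff)
  ultimately show "\<exists>L. ((\<lambda>z. f (r *\<^sub>R z)) has_derivative L) (at z) \<and> (\<forall>c x. L (c *s x) = c * L x)"
    by (auto intro!: exI[of _ "\<lambda>x. L (r *\<^sub>R x)"] simp: L(2))
qed

definition torus_sqnorm :: "(complex ^ 'n \<Rightarrow> complex) \<Rightarrow> real \<Rightarrow> real" where
  "torus_sqnorm f r = (\<integral>t. (norm (f (r *\<^sub>R torus_point t)))\<^sup>2 \<partial>unit_cube)"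

definition torus_inner :: "(complex ^ 'n \<Rightarrow> complex) \<Rightarrow> (complex ^ 'n \<Rightarrow> complex) \<Rightarrow> real \<Rightarrow> complex" where
  "torus_inner f g r = torus_mean (\<lambda>\<zeta>. f (r *\<^sub>R \<zeta>) * cnj (g (r *\<^sub>R \<zeta>)))"

text \<open>The conjugate of g at r zeta is J g at r conj(zeta). Sesquilinear means thereby become
  bilinear pairings, for which radii can be redistributed.\<close>

lemma torus_inner_eq_pairing: "torus_inner f g r = torus_pairing f (standard_conjugation g) r r"
  by (simp add: torus_inner_def torus_pairing_def standard_conjugation_vcnj vcnj_scaleR)

lemma torus_sqnorm_eq_inner: "complex_of_real (torus_sqnorm f r) = torus_inner f f r"
  by (simp only: torus_sqnorm_def torus_inner_def torus_mean_def complex_norm_square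
      flip: integral_complex_of_real)

lemma torus_sqnorm_nonneg: "0 \<le> torus_sqnorm f r"
  by (simp add: torus_sqnorm_def)

lemma integrable_torus_sqnorm:
  assumes "f holomorphic_vec_on polydisc" "0 < r" "r < 1"
  shows "integrable unit_cube (\<lambda>t. (norm (f (r *\<^sub>R torus_point t)))\<^sup>2)"
  using assms by (intro integrable_unit_cube continuous_intros) auto

text \<open>Radius 0 may be included, so f is bounded on a compact set of radii and angles. The
  bound being uniform as r tends to 0 is what the monotonicity argument needs.\<close>

lemma torus_sqnorm_bounded:
  fixes f :: "complex ^ 'n \<Rightarrow> complex"
  assumes f: "f holomorphic_vec_on polydisc" and \<rho>: "0 < \<rho>" "\<rho> < 1"
  obtains B where "\<And>r. 0 < r \<Longrightarrow> r \<le> \<rho> \<Longrightarrow> torus_sqnorm f r \<le> B"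
proof -
  interpret C: prob_space "unit_cube :: (real ^ 'n) measure" by (rule prob_space_unit_cube)
  let ?h = "\<lambda>(r, t). f (r *\<^sub>R torus_point t)"
  have "continuous_on ({0..\<rho>} \<times> cbox 0 1) ?h"
    using \<rho> unfolding case_prod_beta by (intro continuous_intros f) auto
  then have "bounded (?h ` ({0..\<rho>} \<times> cbox 0 1))"
    by (intro compact_imp_bounded compact_continuous_image compact_Times) auto
  then obtain B where B: "\<And>r t. r \<in> {0..\<rho>} \<Longrightarrow> t \<in> cbox 0 1 \<Longrightarrow> norm (f (r *\<^sub>R torus_point t)) \<le> B"
    by (force simp: bounded_iff)
  have "torus_sqnorm f r \<le> B\<^sup>2" if r: "0 < r" "r \<le> \<rho>" for r
  proof -
    have "torus_sqnorm f r \<le> (\<integral>t. B\<^sup>2 \<partial>(unit_cube :: (real ^ 'n) measure))"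
      unfolding torus_sqnorm_def
    proof (rule integral_mono_AE)
      show "integrable unit_cube (\<lambda>t. (norm (f (r *\<^sub>R torus_point t)))\<^sup>2)"
        using r \<rho> by (intro integrable_torus_sqnorm f) auto
      show "AE t in unit_cube. (norm (f (r *\<^sub>R torus_point t)))\<^sup>2 \<le> B\<^sup>2"
        using AE_unit_cube by eventually_elim (use B r in \<open>auto intro!: power_mono\<close>)
    qed simp
    then show ?thesis by (simp add: C.prob_space[simplified])
  qed
  then show ?thesis using that by blast
qed

text \<open>The mean square at s is also the mean of f at radius \<rho> against the conjugate of f
  at radius s^2/\<rho>, since only the product of the radii counts. The inequality 2ab \<le> a^2 +
  b^2 then separates the two radii.\<close>

lemma torus_sqnorm_midpoint:
  fixes f :: "complex ^ 'n \<Rightarrow> complex"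
  assumes f: "f holomorphic_vec_on polydisc" and s: "0 < s" "s < \<rho>" "\<rho> < 1"
  shows "2 * torus_sqnorm f s \<le> torus_sqnorm f \<rho> + torus_sqnorm f (s * s / \<rho>)"
proof -
  define \<tau> where "\<tau> = s * s / \<rho>"
  have "s * s < 1 * \<rho>" using s by (intro mult_strict_mono) auto
  then have \<tau>: "0 < \<tau>" "\<tau> < 1" "s * s = \<rho> * \<tau>" using s by (auto simp: \<tau>_def)
  let ?a = "\<lambda>t. norm (f (\<rho> *\<^sub>R torus_point t))" and ?b = "\<lambda>t. norm (f (\<tau> *\<^sub>R torus_point t))"
  have "complex_of_real (torus_sqnorm f s) = torus_pairing f (standard_conjugation f) \<rho> \<tau>"
    unfolding torus_sqnorm_eq_inner torus_inner_eq_pairing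
    using s \<tau> by (intro torus_pairing_cong f holomorphic_vec_on_standard_conjugation) auto
  also have "\<dots> = (\<integral>t. f (\<rho> *\<^sub>R torus_point t) * cnj (f (\<tau> *\<^sub>R torus_point t)) \<partial>unit_cube)"
    by (simp add: torus_pairing_def torus_mean_def standard_conjugation_vcnj vcnj_scaleR)
  finally have "torus_sqnorm f s = norm \<dots>"
    using torus_sqnorm_nonneg[of f s] by (metis norm_of_real abs_of_nonneg)
  also have "\<dots> \<le> (\<integral>t. norm (f (\<rho> *\<^sub>R torus_point t) * cnj (f (\<tau> *\<^sub>R torus_point t))) \<partial>unit_cube)"
    by (rule integral_norm_bound)
  also have "\<dots> \<le> (\<integral>t. ((?a t)\<^sup>2 + (?b t)\<^sup>2) / 2 \<partial>unit_cube)"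
  proof (rule integral_mono)
    show "integrable unit_cube (\<lambda>t. norm (f (\<rho> *\<^sub>R torus_point t) * cnj (f (\<tau> *\<^sub>R torus_point t))))"
      using s \<tau> by (intro integrable_unit_cube continuous_intros f) auto
    show "integrable unit_cube (\<lambda>t. ((?a t)\<^sup>2 + (?b t)\<^sup>2) / 2)"
      using s \<tau> by (intro integrable_unit_cube continuous_intros f) auto
    show "norm (f (\<rho> *\<^sub>R torus_point t) * cnj (f (\<tau> *\<^sub>R torus_point t))) \<le> ((?a t)\<^sup>2 + (?b t)\<^sup>2) / 2" for t
      using sum_squares_bound[of "?a t" "?b t"] by (simp add: norm_mult)
  qed
  also have "\<dots> = (torus_sqnorm f \<rho> + torus_sqnorm f \<tau>) / 2"
    unfolding torus_sqnorm_def using s \<tau>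
    by (subst Bochner_Integration.integral_add[symmetric]) (auto intro!: integrable_torus_sqnorm f)
  finally show ?thesis by (simp add: \<tau>_def)
qed

text \<open>By the midpoint inequality the values along a geometric sequence of radii tending to
  \<open>0\<close> are convex; being bounded, they cannot increase.\<close>

lemma torus_sqnorm_mono:
  assumes f: "f holomorphic_vec_on polydisc" and s: "0 < s" "s \<le> \<rho>" "\<rho> < 1"
  shows "torus_sqnorm f s \<le> torus_sqnorm f \<rho>"
proof (rule ccontr)
  assume neg: "\<not> ?thesis"
  then have "s < \<rho>" using s by (cases "s = \<rho>") auto
  \<comment> \<open>With this ratio \<open>x 0\<close> and \<open>x 1\<close> are the mean squares
    at \<rho> and at s, so the assumed violation is a positive first increment.\<close>
  define q where "q = s / \<rho>"
  have q: "0 < q" "q < 1" using s \<open>s < \<rho>\<close> by (auto simp: q_def)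
  define x where "x k = torus_sqnorm f (q ^ k * \<rho>)" for k
  have rad: "0 < q ^ k * \<rho>" "q ^ k * \<rho> \<le> \<rho>" for k
    using q s by (auto simp: power_le_one mult_left_le_one_le)
  have convex: "2 * x (Suc k) \<le> x k + x (Suc (Suc k))" for k
  proof -
    have "q ^ Suc k * \<rho> * (q ^ Suc k * \<rho>) / (q ^ k * \<rho>) = q ^ Suc (Suc k) * \<rho>"
      using q s by (simp add: field_simps)
    moreover have "q ^ Suc k * \<rho> < q ^ k * \<rho>"
      using q s by simp
    ultimately show ?thesis
      using torus_sqnorm_midpoint[OF f, of "q ^ Suc k * \<rho>" "q ^ k * \<rho>"] rad[of k] rad[of "Suc k"] s
      unfolding x_def by simp
  qed
  define \<delta> where "\<delta> = x 1 - x 0"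
  have \<delta>: "0 < \<delta>" using neg s by (simp add: \<delta>_def x_def q_def)
  have inc: "\<delta> \<le> x (Suc k) - x k" for k
    by (induction k) (use convex in \<open>auto simp: \<delta>_def intro: order_trans\<close>, smt (verit))
  have "x 0 + real k * \<delta> \<le> x k" for k
  proof (induction k)
    case (Suc k)
    then show ?case using inc[of k] by (simp add: algebra_simps)
  qed simp
  moreover obtain B where "\<And>r. 0 < r \<Longrightarrow> r \<le> \<rho> \<Longrightarrow> torus_sqnorm f r \<le> B"
    using torus_sqnorm_bounded[OF f, of \<rho>] s \<open>s < \<rho>\<close> by auto
  then have "x k \<le> B" for k using rad by (simp add: x_def)
  ultimately have "real k * \<delta> \<le> B - x 0" for k
    by (smt (verit))
  moreover obtain k where "(B - x 0) / \<delta> < real k" using reals_Archimedean2 by blast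
  ultimately show False using \<delta> by (auto simp: divide_less_eq not_le dest: spec[of _ k]) (meson not_le)
qed

section \<open>The Hardy space and its reproducing kernel\<close>

lemma hardy_sqnorm_eq:
  fixes f :: "complex ^ 'n \<Rightarrow> complex"
  assumes f: "f holomorphic_vec_on polydisc" and z: "\<And>z. z \<notin> polydisc \<Longrightarrow> f z = 0"
  shows "hardy_sqnorm f = (SUP r\<in>{0<..<1}. ennreal (torus_sqnorm f r))"
  unfolding hardy_sqnorm_def
proof (rule SUP_cong[OF refl])
  fix r :: real assume r: "r \<in> {0<..<1}"
  \<comment> \<open>Extension by zero makes f Borel measurable on the whole space, as the change of
    variables from the torus measure requires.\<close>
  have "(\<lambda>z. if z \<in> polydisc then f z else 0) \<in> borel_measurable borel"
    by (rule borel_measurable_continuous_on_if) (auto intro: holomorphic_vec_on_imp_continuous_on f)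
  moreover have "(\<lambda>z. if z \<in> polydisc then f z else 0) = f" using z by auto
  ultimately have [measurable]: "f \<in> borel_measurable borel" by simp
  have [measurable]: "torus_point \<in> measurable unit_cube (borel :: (complex ^ 'n) measure)"
    unfolding measurable_cong_sets[OF sets_unit_cube refl]
    by (intro borel_measurable_continuous_onI continuous_on_torus_point continuous_on_id)
  have torus: "(torus_measure :: (complex ^ 'n) measure) = distr unit_cube borel torus_point"
    by (simp add: torus_measure_def unit_cube_def torus_point_def[abs_def])
  have "(\<integral>\<^sup>+ \<zeta>. ennreal ((norm (f (r *\<^sub>R \<zeta>)))\<^sup>2) \<partial>torus_measure) =
      (\<integral>\<^sup>+ t. ennreal ((norm (f (r *\<^sub>R torus_point t)))\<^sup>2) \<partial>unit_cube)"
    unfolding torus by (rule nn_integral_distr) measurable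
  also have "\<dots> = ennreal (torus_sqnorm f r)"
    unfolding torus_sqnorm_def
    using r by (intro nn_integral_eq_integral integrable_torus_sqnorm f) auto
  finally show "(\<integral>\<^sup>+ \<zeta>. ennreal ((norm (f (r *\<^sub>R \<zeta>)))\<^sup>2) \<partial>torus_measure) = ennreal (torus_sqnorm f r)" .
qed

lemma hardy_spaceI:
  assumes f: "f holomorphic_vec_on polydisc" and z: "\<And>z. z \<notin> polydisc \<Longrightarrow> f z = 0"
    and B: "\<And>r. 0 < r \<Longrightarrow> r < 1 \<Longrightarrow> torus_sqnorm f r \<le> B"
  shows "f \<in> hardy_space"
proof -
  have "hardy_sqnorm f = (SUP r\<in>{0<..<1}. ennreal (torus_sqnorm f r))"
    using f z by (rule hardy_sqnorm_eq)
  also have "\<dots> \<le> ennreal B"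
    by (intro SUP_least ennreal_leI B) auto
  finally have "hardy_sqnorm f < \<infinity>" by (rule le_less_trans) simp
  then show ?thesis using f z by (simp add: hardy_space_def)
qed

lemma hardy_spaceD:
  assumes "f \<in> hardy_space"
  shows "f holomorphic_vec_on polydisc" "z \<notin> polydisc \<Longrightarrow> f z = 0"
  using assms by (auto simp: hardy_space_def)

lemma ennreal_hardy_norm:
  assumes "f \<in> hardy_space"
  shows "ennreal ((hardy_norm f)\<^sup>2) = (SUP r\<in>{0<..<1}. ennreal (torus_sqnorm f r))"
proof -
  have "hardy_sqnorm f < \<infinity>" using assms by (simp add: hardy_space_def)
  then show ?thesis
    using hardy_sqnorm_eq[OF hardy_spaceD[OF assms]] by (simp add: hardy_norm_def)
qed

lemma torus_sqnorm_le_hardy_norm: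
  assumes "f \<in> hardy_space" "0 < r" "r < 1"
  shows "torus_sqnorm f r \<le> (hardy_norm f)\<^sup>2"
proof -
  have "ennreal (torus_sqnorm f r) \<le> ennreal ((hardy_norm f)\<^sup>2)"
    unfolding ennreal_hardy_norm[OF assms(1)] using assms by (intro SUP_upper) auto
  then show ?thesis by (simp add: torus_sqnorm_nonneg)
qed

text \<open>Monotonicity turns the supremum into a limit from the left. Limits, unlike suprema,
  respect the differences in the polarization formula.\<close>

lemma hardy_norm_tendsto:
  assumes f: "f \<in> hardy_space"
  shows "(torus_sqnorm f \<longlongrightarrow> (hardy_norm f)\<^sup>2) (at_left 1)"
proof (rule order_tendstoI)
  fix a assume a: "a < (hardy_norm f)\<^sup>2"
  have "\<exists>r\<in>{0<..<1}. a < torus_sqnorm f r"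
  proof (cases "a < 0")
    case True
    then show ?thesis using torus_sqnorm_nonneg[of f] by (intro bexI[of _ "1/2"]) (auto intro: less_le_trans)
  next
    case False
    then have "ennreal a < ennreal ((hardy_norm f)\<^sup>2)" using a by (intro ennreal_lessI) auto
    then obtain r where r: "r \<in> {0<..<1}" "ennreal a < ennreal (torus_sqnorm f r)"
      unfolding ennreal_hardy_norm[OF f] less_SUP_iff by blast
    then show ?thesis using False by (auto simp: ennreal_less_iff)
  qed
  then obtain r where r: "0 < r" "r < 1" "a < torus_sqnorm f r" by auto
  then have "a < torus_sqnorm f s" if "r < s" "s < 1" for s
    using torus_sqnorm_mono[OF hardy_spaceD(1)[OF f], of r s] that by simp
  then show "\<forall>\<^sub>F s in at_left 1. a < torus_sqnorm f s"
    using r by (intro eventually_at_leftI[of r]) auto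
next
  fix a assume "(hardy_norm f)\<^sup>2 < a"
  then show "\<forall>\<^sub>F s in at_left 1. torus_sqnorm f s < a"
    using torus_sqnorm_le_hardy_norm[OF f]
    by (intro eventually_at_leftI[of 0]) (auto intro: le_less_trans)
qed

section \<open>Linear structure and the inner product as a radial limit\<close>

lemma torus_sqnorm_cmult: "torus_sqnorm (\<lambda>z. c * f z) r = (norm c)\<^sup>2 * torus_sqnorm f r"
  by (simp add: torus_sqnorm_def norm_mult power_mult_distrib)

lemma torus_sqnorm_add_le:
  assumes f: "f holomorphic_vec_on polydisc" and g: "g holomorphic_vec_on polydisc" and r: "0 < r" "r < 1"
  shows "torus_sqnorm (\<lambda>z. f z + g z) r \<le> 2 * torus_sqnorm f r + 2 * torus_sqnorm g r"
proof -
  have "torus_sqnorm (\<lambda>z. f z + g z) r \<le>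
      (\<integral>t. 2 * (norm (f (r *\<^sub>R torus_point t)))\<^sup>2 + 2 * (norm (g (r *\<^sub>R torus_point t)))\<^sup>2 \<partial>unit_cube)"
    unfolding torus_sqnorm_def
  proof (rule integral_mono)
    fix t
    let ?a = "f (r *\<^sub>R torus_point t)" and ?b = "g (r *\<^sub>R torus_point t)"
    have "(norm (?a + ?b))\<^sup>2 \<le> (norm ?a + norm ?b)\<^sup>2"
      by (intro power_mono norm_triangle_ineq) auto
    also have "\<dots> \<le> 2 * (norm ?a)\<^sup>2 + 2 * (norm ?b)\<^sup>2"
      using sum_squares_bound[of "norm ?a" "norm ?b"] by (simp add: power2_sum)
    finally show "(norm (?a + ?b))\<^sup>2 \<le> 2 * (norm ?a)\<^sup>2 + 2 * (norm ?b)\<^sup>2" .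
  qed (use r in \<open>auto intro!: integrable_torus_sqnorm[of "\<lambda>z. f z + g z", simplified]
         integrable_torus_sqnorm holomorphic_vec_on_add f g\<close>)
  also have "\<dots> = 2 * torus_sqnorm f r + 2 * torus_sqnorm g r"
    unfolding torus_sqnorm_def
    using r by (subst Bochner_Integration.integral_add) (auto intro!: integrable_torus_sqnorm f g)
  finally show ?thesis .
qed

lemma hardy_space_add:
  assumes f: "f \<in> hardy_space" and g: "g \<in> hardy_space"
  shows "(\<lambda>z. f z + g z) \<in> hardy_space"
proof (rule hardy_spaceI)
  fix r :: real assume r: "0 < r" "r < 1"
  show "torus_sqnorm (\<lambda>z. f z + g z) r \<le> 2 * (hardy_norm f)\<^sup>2 + 2 * (hardy_norm g)\<^sup>2"
    using torus_sqnorm_add_le[OF hardy_spaceD(1)[OF f] hardy_spaceD(1)[OF g] r]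
      torus_sqnorm_le_hardy_norm[OF f r] torus_sqnorm_le_hardy_norm[OF g r] by simp
qed (use hardy_spaceD[OF f] hardy_spaceD[OF g] in \<open>auto intro: holomorphic_vec_on_add\<close>)

lemma hardy_space_cmult:
  assumes f: "f \<in> hardy_space"
  shows "(\<lambda>z. c * f z) \<in> hardy_space"
proof (rule hardy_spaceI)
  fix r :: real assume r: "0 < r" "r < 1"
  show "torus_sqnorm (\<lambda>z. c * f z) r \<le> (norm c)\<^sup>2 * (hardy_norm f)\<^sup>2"
    unfolding torus_sqnorm_cmult by (intro mult_left_mono torus_sqnorm_le_hardy_norm f r) auto
qed (use hardy_spaceD[OF f] in \<open>auto intro: holomorphic_vec_on_mult holomorphic_vec_on_const\<close>)

lemma hardy_space_diff:
  assumes f: "f \<in> hardy_space" and g: "g \<in> hardy_space"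
  shows "(\<lambda>z. f z - g z) \<in> hardy_space"
  using hardy_space_add[OF f hardy_space_cmult[OF g, of "-1"]] by simp

lemma complex_polarization:
  "4 * (a * cnj b) = of_real ((norm (a + b))\<^sup>2) - of_real ((norm (a - b))\<^sup>2)
      + \<i> * of_real ((norm (a + \<i> * b))\<^sup>2) - \<i> * of_real ((norm (a - \<i> * b))\<^sup>2)"
  unfolding complex_norm_square by (simp add: algebra_simps)

text \<open>Polarization holds pointwise under the integral, and each of the four squared norms in
  the definition is a limit of mean squares. Identities for torus integrals can henceforth be
  transferred to the inner product.\<close>

lemma hardy_inner_tendsto:
  assumes f: "f \<in> hardy_space" and g: "g \<in> hardy_space"
  shows "(torus_inner f g \<longlongrightarrow> hardy_inner f g) (at_left 1)"
proof -
  let ?N = "\<lambda>h r. complex_of_real (torus_sqnorm h r)"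
  have ig: "(\<lambda>z. \<i> * g z) \<in> hardy_space" using g by (rule hardy_space_cmult)
  note mem = hardy_space_add[OF f g] hardy_space_diff[OF f g] hardy_space_add[OF f ig] hardy_space_diff[OF f ig]
  let ?P = "\<lambda>r. (?N (\<lambda>z. f z + g z) r - ?N (\<lambda>z. f z - g z) r
      + \<i> * ?N (\<lambda>z. f z + \<i> * g z) r - \<i> * ?N (\<lambda>z. f z - \<i> * g z) r) / 4"
  have "(?P \<longlongrightarrow> hardy_inner f g) (at_left 1)"
    unfolding hardy_inner_def by (intro tendsto_intros hardy_norm_tendsto mem) simp
  moreover have "?P r = torus_inner f g r" if r: "0 < r" "r < 1" for r
  proof -
    have int: "integrable unit_cube (\<lambda>t. complex_of_real ((norm (h (r *\<^sub>R torus_point t)))\<^sup>2))"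
      if "h \<in> hardy_space" for h :: "complex ^ 'a \<Rightarrow> complex"
      using r by (intro integrable_of_real integrable_torus_sqnorm hardy_spaceD(1)[OF that])
    note ints = mem[THEN int]
    have "?P r = (\<integral>t. 4 * (f (r *\<^sub>R torus_point t) * cnj (g (r *\<^sub>R torus_point t))) \<partial>unit_cube) / 4"
      unfolding complex_polarization torus_sqnorm_def integral_complex_of_real[symmetric]
      using ints by (simp del: of_real_power)
    then show ?thesis by (simp add: torus_inner_def torus_mean_def)
  qed
  then have "\<forall>\<^sub>F r in at_left 1. ?P r = torus_inner f g r"
    by (intro eventually_at_leftI[of 0]) auto
  ultimately show ?thesis by (rule Lim_transform_eventually)
qed

lemma hardy_inner_eqI:
  assumes "f \<in> hardy_space" "g \<in> hardy_space"
    and "(torus_inner f g \<longlongrightarrow> l) (at_left 1)"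
  shows "hardy_inner f g = l"
  using tendsto_unique[OF _ hardy_inner_tendsto[OF assms(1,2)] assms(3)] by simp

lemma torus_inner_commute: "torus_inner g f r = cnj (torus_inner f g r)"
  unfolding torus_inner_def torus_mean_def by (subst Bochner_Integration.integral_cnj[symmetric]) (simp add: mult.commute)

lemma hardy_inner_commute:
  assumes f: "f \<in> hardy_space" and g: "g \<in> hardy_space"
  shows "hardy_inner g f = cnj (hardy_inner f g)"
proof (rule hardy_inner_eqI[OF g f])
  show "(torus_inner g f \<longlongrightarrow> cnj (hardy_inner f g)) (at_left 1)"
    unfolding torus_inner_commute[of g f, abs_def] by (intro tendsto_cnj hardy_inner_tendsto f g)
qed

lemma hardy_inner_cmult:
  assumes f: "f \<in> hardy_space" and g: "g \<in> hardy_space"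
  shows "hardy_inner (\<lambda>z. c * f z) g = c * hardy_inner f g"
proof (rule hardy_inner_eqI[OF hardy_space_cmult[OF f] g])
  have "torus_inner (\<lambda>z. c * f z) g = (\<lambda>r. c * torus_inner f g r)"
    by (simp add: fun_eq_iff torus_inner_def torus_mean_def mult.assoc)
  then show "(torus_inner (\<lambda>z. c * f z) g \<longlongrightarrow> c * hardy_inner f g) (at_left 1)"
    by (auto intro!: tendsto_intros hardy_inner_tendsto f g)
qed

text \<open>The mean square of f is the pairing of f with J f, and J exchanges the two; symmetry of
  the pairing shows that J preserves every mean square.\<close>

lemma hardy_space_standard_conjugation:
  assumes f: "f \<in> hardy_space"
  shows "standard_conjugation f \<in> hardy_space"
proof (rule hardy_spaceI)
  show "standard_conjugation f holomorphic_vec_on polydisc"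
    by (intro holomorphic_vec_on_standard_conjugation hardy_spaceD[OF f])
  show "standard_conjugation f z = 0" if "z \<notin> polydisc" for z
    using hardy_spaceD(2)[OF f] that by (simp add: standard_conjugation_vcnj)
  fix r :: real assume r: "0 < r" "r < 1"
  have "complex_of_real (torus_sqnorm (standard_conjugation f) r) = torus_sqnorm f r"
    unfolding torus_sqnorm_eq_inner torus_inner_eq_pairing standard_conjugation_twice
    by (intro torus_pairing_sym holomorphic_vec_on_standard_conjugation hardy_spaceD[OF f] r)
  then show "torus_sqnorm (standard_conjugation f) r \<le> (hardy_norm f)\<^sup>2"
    using torus_sqnorm_le_hardy_norm[OF f r] by simp
qed

text \<open>The Szego kernel of the polydisc, cut off like every element of the Hardy space.\<close>

definition hardy_kernel :: "complex ^ 'n \<Rightarrow> complex ^ 'n \<Rightarrow> complex" where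
  "hardy_kernel w z = (if z \<in> polydisc then \<Prod>i\<in>UNIV. 1 / (1 - cnj (w $ i) * z $ i) else 0)"

lemma holomorphic_vec_on_hardy_kernel:
  assumes w: "w \<in> polydisc"
  shows "hardy_kernel w holomorphic_vec_on polydisc"
proof (rule holomorphic_vec_on_cong)
  show "(\<lambda>z. \<Prod>i\<in>UNIV. 1 / (1 - cnj (w $ i) * z $ i)) holomorphic_vec_on polydisc"
  proof (rule holomorphic_vec_on_prod)
    fix i
    have "1 - cnj (w $ i) * x \<noteq> 0" if "x \<in> ball 0 1" for x
      using w that by (intro one_minus_mult_neq_0) (auto simp: polydisc_def intro: less_imp_le)
    then have "(\<lambda>x. 1 / (1 - cnj (w $ i) * x)) holomorphic_on ball 0 1"
      by (intro holomorphic_intros) auto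
    from holomorphic_vec_on_compose[OF holomorphic_vec_on_nth this]
    show "(\<lambda>z. 1 / (1 - cnj (w $ i) * z $ i)) holomorphic_vec_on polydisc"
      by (auto simp: polydisc_def)
  qed
qed (simp add: hardy_kernel_def)

text \<open>The kernel is also taken at radius r, and this r can be moved to the point w. Cauchy's
  formula at radius r then contributes a second factor r, hence \<open>r * r\<close>.\<close>

lemma torus_inner_hardy_kernel:
  assumes f: "f holomorphic_vec_on polydisc" and w: "w \<in> polydisc" and r: "0 < r" "r < 1"
  shows "torus_inner f (hardy_kernel w) r = f ((r * r) *\<^sub>R w)"
proof -
  have "torus_inner f (hardy_kernel w) r =
      torus_mean (\<lambda>\<zeta>. f (r *\<^sub>R \<zeta>) * (\<Prod>i\<in>UNIV. 1 / (1 - (r *\<^sub>R w) $ i * cnj (\<zeta> $ i))))"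
    using r by (simp add: torus_inner_def torus_mean_def hardy_kernel_def)
  also have "\<dots> = f (r *\<^sub>R (r *\<^sub>R w))"
    using r w by (intro torus_Cauchy f) (auto intro: polydisc_scaleR)
  finally show ?thesis by simp
qed

text \<open>Reproducing the kernel by itself gives its mean square as the value at
  \<open>(r * r) *\<^sub>R w\<close>, whose factors are bounded independently of r by the triangle
  inequality.\<close>

lemma hardy_space_kernel:
  assumes w: "w \<in> polydisc"
  shows "hardy_kernel w \<in> hardy_space"
proof (rule hardy_spaceI[OF holomorphic_vec_on_hardy_kernel[OF w]])
  fix r :: real assume r: "0 < r" "r < 1"
  have "complex_of_real (torus_sqnorm (hardy_kernel w) r) = hardy_kernel w ((r * r) *\<^sub>R w)"
    unfolding torus_sqnorm_eq_inner
    by (rule torus_inner_hardy_kernel[OF holomorphic_vec_on_hardy_kernel[OF w] w r])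
  then have "torus_sqnorm (hardy_kernel w) r = norm (hardy_kernel w ((r * r) *\<^sub>R w))"
    by (metis norm_of_real abs_of_nonneg torus_sqnorm_nonneg)
  also have "\<dots> \<le> (\<Prod>i\<in>UNIV. 1 / (1 - norm (w $ i)))"
  proof -
    have w1: "norm (w $ i) < 1" for i using w by (simp add: polydisc_def)
    have rr: "\<bar>r * r\<bar> \<le> 1" using r mult_strict_mono[of r 1 r 1] by simp
    have "norm (1 / (1 - cnj (w $ i) * ((r * r) *\<^sub>R w) $ i)) \<le> 1 / (1 - norm (w $ i))" for i
    proof -
      have "norm (cnj (w $ i) * ((r * r) *\<^sub>R w) $ i) \<le> norm (w $ i) * 1"
        unfolding norm_mult complex_mod_cnj
        using w1[of i] rr polydisc_scaleR[OF rr w]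
        by (intro mult_left_mono) (auto simp: polydisc_def intro: less_imp_le)
      then have "1 - norm (w $ i) \<le> norm (1 - cnj (w $ i) * ((r * r) *\<^sub>R w) $ i)"
        using norm_triangle_ineq2[of 1 "cnj (w $ i) * ((r * r) *\<^sub>R w) $ i"] by simp
      then show ?thesis using w1[of i] unfolding norm_divide norm_one by (intro divide_left_mono) (auto intro!: mult_pos_pos)
    qed
    then show ?thesis
      using polydisc_scaleR[OF rr w] unfolding hardy_kernel_def
      by (simp only: if_True) (auto simp only: prod_norm[symmetric] intro!: prod_mono norm_ge_zero)
  qed
  finally show "torus_sqnorm (hardy_kernel w) r \<le> (\<Prod>i\<in>UNIV. 1 / (1 - norm (w $ i)))" .
qed (simp add: hardy_kernel_def)

lemma radial_limit:
  assumes f: "f holomorphic_vec_on polydisc" and w: "w \<in> polydisc"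
  shows "((\<lambda>r. f ((r * r) *\<^sub>R w)) \<longlongrightarrow> f w) (at_left 1)"
proof -
  have "isCont f w"
    using holomorphic_vec_on_imp_continuous_on[OF f] w by (simp add: continuous_on_eq_continuous_at)
  moreover have "((\<lambda>r::real. (r * r) *\<^sub>R w) \<longlongrightarrow> (1 * 1) *\<^sub>R w) (at_left 1)"
    by (intro tendsto_intros)
  ultimately show ?thesis using isCont_tendsto_compose[of w f] by simp
qed

lemma hardy_inner_kernel:
  assumes f: "f \<in> hardy_space" and w: "w \<in> polydisc"
  shows "hardy_inner f (hardy_kernel w) = f w"
proof (rule hardy_inner_eqI[OF f hardy_space_kernel[OF w]])
  note hf = hardy_spaceD(1)[OF f]
  have "\<forall>\<^sub>F r in at_left 1. f ((r * r) *\<^sub>R w) = torus_inner f (hardy_kernel w) r"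
    by (intro eventually_at_leftI[of 0]) (use torus_inner_hardy_kernel[OF hf w] in auto)
  with radial_limit[OF hf w] show "(torus_inner f (hardy_kernel w) \<longlongrightarrow> f w) (at_left 1)"
    by (rule Lim_transform_eventually)
qed

lemma hardy_inner_cnj_cmult_kernel:
  assumes f: "f \<in> hardy_space" and w: "w \<in> polydisc"
  shows "hardy_inner f (\<lambda>z. c * hardy_kernel w z) = cnj c * f w"
  using hardy_inner_commute[OF hardy_space_cmult[OF hardy_space_kernel[OF w]] f, of c]
    hardy_inner_cmult[OF hardy_space_kernel[OF w] f, of c]
    hardy_inner_commute[OF f hardy_space_kernel[OF w]] hardy_inner_kernel[OF f w]
  by simp

text \<open>The description needs uniqueness: two candidates have equal inner products with every
  kernel and therefore equal values on the polydisc, while both vanish outside.\<close>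

lemma hardy_adjoint_eqI:
  assumes h: "h \<in> hardy_space"
    and eq: "\<And>f. f \<in> hardy_space \<Longrightarrow> hardy_inner (T f) g = hardy_inner f h"
  shows "hardy_adjoint T g = h"
  unfolding hardy_adjoint_def
proof (rule the_equality)
  fix k assume k: "k \<in> hardy_space \<and> (\<forall>f\<in>hardy_space. hardy_inner (T f) g = hardy_inner f k)"
  have "k w = h w" for w
  proof (cases "w \<in> polydisc")
    case True
    note K = hardy_space_kernel[OF True]
    have "hardy_inner (hardy_kernel w) k = hardy_inner (hardy_kernel w) h"
      using k eq K by simp
    then show ?thesis
      using hardy_inner_commute[OF _ K, of k] hardy_inner_commute[OF h K] k h True
      by (simp add: hardy_inner_kernel hardy_inner_commute[OF K])
  next
    case False
    then show ?thesis using k h by (simp add: hardy_spaceD(2))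
  qed
  then show "k = h" by (simp add: fun_eq_iff)
qed (use h eq in auto)

section \<open>Necessity\<close>

lemma standard_conjugation_hardy_kernel:
  "standard_conjugation (hardy_kernel w) = hardy_kernel (vcnj w)"
  by (simp add: fun_eq_iff standard_conjugation_vcnj hardy_kernel_def)

lemma hardy_adjoint_weighted_composition_kernel:
  assumes V: "\<And>z. z \<in> polydisc \<Longrightarrow> V z \<in> polydisc"
    and bounded: "bounded_hardy_operator (weighted_composition u V)" and w: "w \<in> polydisc"
  shows "hardy_adjoint (weighted_composition u V) (hardy_kernel w) = (\<lambda>z. cnj (u w) * hardy_kernel (V w) z)"
proof (rule hardy_adjoint_eqI)
  show "(\<lambda>z. cnj (u w) * hardy_kernel (V w) z) \<in> hardy_space"
    by (intro hardy_space_cmult hardy_space_kernel V w)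
next
  fix f :: "complex ^ 'a \<Rightarrow> complex" assume f: "f \<in> hardy_space"
  then have "weighted_composition u V f \<in> hardy_space"
    using bounded by (simp add: bounded_hardy_operator_def)
  then show "hardy_inner (weighted_composition u V f) (hardy_kernel w) =
      hardy_inner f (\<lambda>z. cnj (u w) * hardy_kernel (V w) z)"
    using w f V by (simp add: hardy_inner_kernel hardy_inner_cnj_cmult_kernel weighted_composition_def)
qed

lemma J_symmetric_imp_kernel_identity:
  assumes V: "\<And>z. z \<in> polydisc \<Longrightarrow> V z \<in> polydisc"
    and J: "J_symmetric (weighted_composition u V)" and z: "z \<in> polydisc" and w: "w \<in> polydisc"
  shows "u z * (\<Prod>i\<in>UNIV. 1 / (1 - w $ i * V z $ i)) = u w * (\<Prod>i\<in>UNIV. 1 / (1 - V w $ i * z $ i))"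
proof -
  let ?T = "weighted_composition u V"
  have T: "bounded_hardy_operator ?T" using J by (simp add: J_symmetric_def)
  \<comment> \<open>Testing at the conjugate point lets J produce the kernel at w and leaves an
    identity free of conjugates.\<close>
  have "hardy_kernel (vcnj w) \<in> hardy_space" using w by (intro hardy_space_kernel) simp
  then have "?T (hardy_kernel (vcnj w)) =
      standard_conjugation (hardy_adjoint ?T (standard_conjugation (hardy_kernel (vcnj w))))"
    using J by (simp add: J_symmetric_def)
  also have "\<dots> = standard_conjugation (\<lambda>z. cnj (u w) * hardy_kernel (V w) z)"
    by (simp add: standard_conjugation_hardy_kernel hardy_adjoint_weighted_composition_kernel[OF V T w])
  finally have "?T (hardy_kernel (vcnj w)) z = standard_conjugation (\<lambda>z. cnj (u w) * hardy_kernel (V w) z) z"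
    by simp
  then show ?thesis
    using z V by (simp add: weighted_composition_def standard_conjugation_vcnj hardy_kernel_def)
qed

lemma prod_UNIV_single:
  fixes g :: "'n::finite \<Rightarrow> 'b::comm_monoid_mult"
  assumes "\<And>i. i \<noteq> j \<Longrightarrow> g i = 1"
  shows "(\<Prod>i\<in>UNIV. g i) = g j"
  using assms by (subst prod.remove[of UNIV j]) (auto intro!: prod.neutral)

lemma J_symmetric_imp_form:
  fixes u :: "complex ^ 'n \<Rightarrow> complex" and v :: "'n \<Rightarrow> complex \<Rightarrow> complex"
  assumes nonzero: "\<exists>z\<in>polydisc. u z \<noteq> 0"
    and v: "\<And>j. v j holomorphic_on ball 0 1" "\<And>j. v j ` ball 0 1 \<subseteq> ball 0 1"
    and J: "J_symmetric (weighted_composition u (\<lambda>z. \<chi> j. v j (z $ j)))"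
  shows "\<forall>z\<in>polydisc. u z = u 0 * (\<Prod>i\<in>UNIV. 1 / (1 - v i 0 * z $ i))"
    and "\<forall>z\<in>ball 0 1. v j z = ((deriv (v j) 0 - (v j 0)\<^sup>2) * z + v j 0) / (1 - v j 0 * z)"
proof -
  have v1: "norm (v j x) < 1" if "norm x < 1" for j x
    using v(2)[of j] that by (auto simp: image_subset_iff)
  have id: "u z * (\<Prod>i\<in>UNIV. 1 / (1 - w $ i * v i (z $ i))) = u w * (\<Prod>i\<in>UNIV. 1 / (1 - v i (w $ i) * z $ i))"
    if "z \<in> polydisc" "w \<in> polydisc" for z w
    using J_symmetric_imp_kernel_identity[OF _ J that] v1 by (simp add: polydisc_def)
  have 0: "(0 :: complex ^ 'n) \<in> polydisc" by (simp add: polydisc_def)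
  show u: "\<forall>z\<in>polydisc. u z = u 0 * (\<Prod>i\<in>UNIV. 1 / (1 - v i 0 * z $ i))"
    using id[OF _ 0] by simp
  \<comment> \<open>By the formula just shown, \<open>u 0 = 0\<close> would make u vanish
    identically; the factor \<open>u 0\<close> can thus be cancelled below.\<close>
  then have a: "u 0 \<noteq> 0" using nonzero by auto
  show "\<forall>z\<in>ball 0 1. v j z = ((deriv (v j) 0 - (v j 0)\<^sup>2) * z + v j 0) / (1 - v j 0 * z)"
  proof
    fix x :: complex assume x: "x \<in> ball 0 1"
    define c where "c = v j 0"
    have c: "norm c < 1" using v1[of 0 j] by (simp add: c_def)
    have axis: "axis j y \<in> polydisc" if "norm y < 1" for y :: complex
      using that by (simp add: polydisc_def axis_def)
    have ua: "u (axis j y) = u 0 * (1 / (1 - c * y))" if "norm y < 1" for y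
      using bspec[OF u axis[OF that]]
      by (subst (asm) prod_UNIV_single[of j]) (auto simp: axis_def c_def)
    \<comment> \<open>For two points on the j-th axis all other factors are 1, and u is known
      there.\<close>
    have "(1 - c * x) * (1 - y * v j x) = (1 - c * y) * (1 - v j y * x)" if y: "norm y < 1" for y
    proof -
      have nx: "norm x < 1" using x by simp
      have "u (axis j x) * (1 / (1 - y * v j x)) = u (axis j y) * (1 / (1 - v j y * x))"
        using id[OF axis[OF nx] axis[OF y]]
        by (subst (asm) prod_UNIV_single[of j], simp add: axis_def)
           (subst (asm) prod_UNIV_single[of j], auto simp: axis_def)
      then show ?thesis
        using a one_minus_mult_neq_0[OF y, of "v j x"] one_minus_mult_neq_0[OF v1[OF y], of x]
          one_minus_mult_neq_0[OF c, of x] one_minus_mult_neq_0[OF c, of y] nx y v1[OF nx]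
        by (simp add: ua field_simps)
    qed
    then have eq: "\<forall>\<^sub>F y in nhds 0. (1 - c * x) * (1 - y * v j x) = (1 - c * y) * (1 - v j y * x)"
      by (intro eventually_nhds_in_open[of "ball 0 1", THEN eventually_mono]) auto
    have "(v j has_field_derivative deriv (v j) 0) (at 0)"
      by (rule holomorphic_derivI[OF v(1)]) auto
    then have "((\<lambda>y. (1 - c * y) * (1 - v j y * x)) has_field_derivative - c * (1 - c * x) - deriv (v j) 0 * x) (at 0)"
      by (auto intro!: derivative_eq_intros simp: c_def)
    moreover have "((\<lambda>y. (1 - c * x) * (1 - y * v j x)) has_field_derivative - ((1 - c * x) * v j x)) (at 0)"
      by (auto intro!: derivative_eq_intros)
    \<comment> \<open>Comparing the derivatives in y at 0 isolates \<open>v j x\<close>, since y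
      multiplies it on the left.\<close>
    ultimately have "- ((1 - c * x) * v j x) = - c * (1 - c * x) - deriv (v j) 0 * x"
      using DERIV_cong_ev[OF refl eq refl] DERIV_unique by blast
    then have "v j x * (1 - c * x) = (deriv (v j) 0 - c\<^sup>2) * x + c"
      by (simp add: algebra_simps power2_eq_square)
    then show "v j x = ((deriv (v j) 0 - (v j 0)\<^sup>2) * x + v j 0) / (1 - v j 0 * x)"
      using one_minus_mult_neq_0[OF c, of x] x by (simp add: c_def field_simps)
  qed
qed

section \<open>Dilations\<close>

lemma hardy_inner_diff:
  assumes f: "f \<in> hardy_space" and g: "g \<in> hardy_space" and h: "h \<in> hardy_space"
  shows "hardy_inner (\<lambda>z. f z - g z) h = hardy_inner f h - hardy_inner g h"
proof (rule hardy_inner_eqI[OF hardy_space_diff[OF f g] h])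
  have "torus_inner f h r - torus_inner g h r = torus_inner (\<lambda>z. f z - g z) h r" if "0 < r" "r < 1" for r
    unfolding torus_inner_def torus_mean_def left_diff_distrib using that
    by (intro Bochner_Integration.integral_diff[symmetric] integrable_unit_cube continuous_intros
        f h g hardy_spaceD) auto
  then have "\<forall>\<^sub>F r in at_left 1. torus_inner f h r - torus_inner g h r = torus_inner (\<lambda>z. f z - g z) h r"
    by (intro eventually_at_leftI[of 0]) auto
  moreover have "((\<lambda>r. torus_inner f h r - torus_inner g h r) \<longlongrightarrow> hardy_inner f h - hardy_inner g h) (at_left 1)"
    by (intro tendsto_intros hardy_inner_tendsto f g h)
  ultimately show "(torus_inner (\<lambda>z. f z - g z) h \<longlongrightarrow> hardy_inner f h - hardy_inner g h) (at_left 1)"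
    by (rule Lim_transform_eventually[rotated])
qed

text \<open>Weighted inequality 2ab \<le> t a^2 + b^2/t under the integral; the free weight t is
  optimized in the Cauchy-Schwarz inequality after the radial limit.\<close>

lemma torus_inner_le:
  assumes f: "f holomorphic_vec_on polydisc" and g: "g holomorphic_vec_on polydisc"
    and r: "0 < r" "r < 1" and t: "0 < t"
  shows "norm (torus_inner f g r) \<le> (t * torus_sqnorm f r + torus_sqnorm g r / t) / 2"
proof -
  let ?a = "\<lambda>x. norm (f (r *\<^sub>R torus_point x))" and ?b = "\<lambda>x. norm (g (r *\<^sub>R torus_point x))"
  have "norm (torus_inner f g r) \<le> (\<integral>x. norm (f (r *\<^sub>R torus_point x) * cnj (g (r *\<^sub>R torus_point x))) \<partial>unit_cube)"
    unfolding torus_inner_def torus_mean_def by (rule integral_norm_bound)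
  also have "\<dots> \<le> (\<integral>x. (t * (?a x)\<^sup>2 + (?b x)\<^sup>2 / t) / 2 \<partial>unit_cube)"
  proof (rule integral_mono)
    show "integrable unit_cube (\<lambda>x. norm (f (r *\<^sub>R torus_point x) * cnj (g (r *\<^sub>R torus_point x))))"
      using r by (intro integrable_unit_cube continuous_intros f g) auto
    show "integrable unit_cube (\<lambda>x. (t * (?a x)\<^sup>2 + (?b x)\<^sup>2 / t) / 2)"
      using r t by (intro integrable_unit_cube continuous_intros f g) auto
    show "norm (f (r *\<^sub>R torus_point x) * cnj (g (r *\<^sub>R torus_point x))) \<le> (t * (?a x)\<^sup>2 + (?b x)\<^sup>2 / t) / 2" for x
    proof -
      have "2 * t * (?a x * ?b x) \<le> (t * ?a x)\<^sup>2 + (?b x)\<^sup>2"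
        using sum_squares_bound[of "t * ?a x" "?b x"] by (simp add: mult_ac)
      then show ?thesis using t by (simp add: norm_mult field_simps power2_eq_square)
    qed
  qed
  also have "\<dots> = (t * torus_sqnorm f r + torus_sqnorm g r / t) / 2"
    unfolding torus_sqnorm_def using r
    by (simp add: Bochner_Integration.integral_add integrable_torus_sqnorm f g)
  finally show ?thesis .
qed

lemma hardy_norm_nonneg: "0 \<le> hardy_norm f"
  by (simp add: hardy_norm_def)

lemma hardy_Cauchy_Schwarz:
  assumes f: "f \<in> hardy_space" and g: "g \<in> hardy_space"
  shows "norm (hardy_inner f g) \<le> hardy_norm f * hardy_norm g"
proof -
  let ?A = "hardy_norm f" and ?B = "hardy_norm g"
  have AB: "0 \<le> ?A" "0 \<le> ?B" by (simp_all add: hardy_norm_nonneg)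
  have le: "norm (hardy_inner f g) \<le> (t * ?A\<^sup>2 + ?B\<^sup>2 / t) / 2" if t: "0 < t" for t
  proof (rule tendsto_le[OF _ _ tendsto_norm[OF hardy_inner_tendsto[OF f g]]])
    show "((\<lambda>r. (t * torus_sqnorm f r + torus_sqnorm g r / t) / 2) \<longlongrightarrow> (t * ?A\<^sup>2 + ?B\<^sup>2 / t) / 2) (at_left 1)"
      using t by (intro tendsto_intros hardy_norm_tendsto f g) auto
    show "\<forall>\<^sub>F r in at_left 1. norm (torus_inner f g r) \<le> (t * torus_sqnorm f r + torus_sqnorm g r / t) / 2"
      using torus_inner_le[OF hardy_spaceD(1)[OF f] hardy_spaceD(1)[OF g] _ _ t]
      by (intro eventually_at_leftI[of 0]) auto
  qed simp
  \<comment> \<open>The optimal weight would be t = B/A for the norms A and B; adding e to both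
    keeps it positive when a norm is 0, and e tends to 0 afterwards.\<close>
  have e: "norm (hardy_inner f g) \<le> (?A + e) * (?B + e)" if e: "0 < e" for e
  proof -
    have pos: "0 < ?A + e" "0 < ?B + e" using AB e by auto
    have "?A\<^sup>2 \<le> (?A + e)\<^sup>2" "?B\<^sup>2 \<le> (?B + e)\<^sup>2" using AB e by (auto intro!: power_mono)
    then have "(?B + e) / (?A + e) * ?A\<^sup>2 \<le> (?B + e) / (?A + e) * (?A + e)\<^sup>2"
        "?B\<^sup>2 / ((?B + e) / (?A + e)) \<le> (?B + e)\<^sup>2 / ((?B + e) / (?A + e))"
      using pos by (auto intro!: mult_left_mono divide_right_mono simp del: divide_divide_eq_right)
    moreover have "(?B + e) / (?A + e) * (?A + e)\<^sup>2 = (?A + e) * (?B + e)"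
        "(?B + e)\<^sup>2 / ((?B + e) / (?A + e)) = (?A + e) * (?B + e)"
      using pos by (auto simp: power2_eq_square)
    ultimately have bd: "(?B + e) / (?A + e) * ?A\<^sup>2 \<le> (?A + e) * (?B + e)"
        "?B\<^sup>2 / ((?B + e) / (?A + e)) \<le> (?A + e) * (?B + e)" by (simp_all only:)
    have "norm (hardy_inner f g) \<le> ((?B + e) / (?A + e) * ?A\<^sup>2 + ?B\<^sup>2 / ((?B + e) / (?A + e))) / 2"
      using pos by (intro le) simp
    also have "\<dots> \<le> ((?A + e) * (?B + e) + (?A + e) * (?B + e)) / 2"
      by (intro divide_right_mono add_mono bd) simp
    finally show ?thesis by simp
  qed
  have "((\<lambda>e. (?A + e) * (?B + e)) \<longlongrightarrow> (?A + 0) * (?B + 0)) (at_right 0)"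
    by (intro tendsto_intros)
  moreover have "\<forall>\<^sub>F e in at_right 0. norm (hardy_inner f g) \<le> (?A + e) * (?B + e)"
    using e by (intro eventually_at_rightI[of 0 1]) auto
  ultimately have "norm (hardy_inner f g) \<le> (?A + 0) * (?B + 0)"
    by (intro tendsto_lowerbound) auto
  then show ?thesis by simp
qed

section \<open>Dilates and their convergence in norm\<close>

definition hardy_dilation :: "real \<Rightarrow> (complex ^ 'n \<Rightarrow> complex) \<Rightarrow> complex ^ 'n \<Rightarrow> complex" where
  "hardy_dilation s f z = (if z \<in> polydisc then f (s *\<^sub>R z) else 0)"

lemma holomorphic_vec_on_hardy_dilation:
  assumes "f holomorphic_vec_on polydisc" "0 < s" "s < 1"
  shows "hardy_dilation s f holomorphic_vec_on polydisc"
  by (rule holomorphic_vec_on_cong[OF holomorphic_vec_on_dilate[OF assms(1), of s]])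
     (use assms in \<open>auto simp: hardy_dilation_def\<close>)

lemma torus_sqnorm_hardy_dilation:
  assumes "0 < r" "r < 1"
  shows "torus_sqnorm (hardy_dilation s f) r = torus_sqnorm f (s * r)"
  using assms by (simp add: torus_sqnorm_def hardy_dilation_def)

lemma hardy_space_hardy_dilation:
  assumes f: "f \<in> hardy_space" and s: "0 < s" "s < 1"
  shows "hardy_dilation s f \<in> hardy_space"
proof (rule hardy_spaceI)
  show "hardy_dilation s f holomorphic_vec_on polydisc"
    by (intro holomorphic_vec_on_hardy_dilation hardy_spaceD f s)
  show "torus_sqnorm (hardy_dilation s f) r \<le> (hardy_norm f)\<^sup>2" if r: "0 < r" "r < 1" for r
    unfolding torus_sqnorm_hardy_dilation[OF r]
    using torus_sqnorm_le_hardy_norm[OF f, of "s * r"] mult_strict_mono[of s 1 r 1] r s by simp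
qed (simp add: hardy_dilation_def)

lemma norm_diff_square: "(norm (a - b))\<^sup>2 = (norm a)\<^sup>2 + (norm b)\<^sup>2 - 2 * Re (a * cnj b)" for a b :: complex
  unfolding cmod_power2 by (simp add: power2_eq_square algebra_simps)

text \<open>With M for the mean square of f, the cross term at radius r pairs the radii r and
  \<open>\<sigma> * \<sigma> * r\<close>, whose geometric mean is \<open>\<sigma> * r\<close>, so it
  equals M(\<sigma> r). The squared difference is M(r) + M(\<sigma>^2 r) - 2 M(\<sigma> r), which
  monotonicity bounds. The bound tends to 0 as \<sigma> tends to 1.\<close>

lemma hardy_norm_dilation_diff:
  fixes f :: "complex ^ 'n \<Rightarrow> complex"
  assumes f: "f \<in> hardy_space" and \<sigma>: "0 < \<sigma>" "\<sigma> < 1"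
  shows "(hardy_norm (\<lambda>z. f z - hardy_dilation (\<sigma> * \<sigma>) f z))\<^sup>2 \<le> (hardy_norm f)\<^sup>2 - torus_sqnorm f (\<sigma> * \<sigma>)"
proof (rule tendsto_upperbound)
  let ?d = "hardy_dilation (\<sigma> * \<sigma>) f"
  note hf = hardy_spaceD(1)[OF f]
  have s: "0 < \<sigma> * \<sigma>" "\<sigma> * \<sigma> < 1" using \<sigma> mult_strict_mono[of \<sigma> 1 \<sigma> 1] by auto
  note d = hardy_space_hardy_dilation[OF f s]
  note hd = hardy_spaceD(1)[OF d]
  show "(torus_sqnorm (\<lambda>z. f z - ?d z) \<longlongrightarrow> (hardy_norm (\<lambda>z. f z - ?d z))\<^sup>2) (at_left 1)"
    by (intro hardy_norm_tendsto hardy_space_diff f d)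
  \<comment> \<open>Radii above \<sigma> suffice for the limit and satisfy
    \<open>\<sigma> * \<sigma> \<le> \<sigma> * r\<close>, which makes the final bound independent
    of r.\<close>
  have "torus_sqnorm (\<lambda>z. f z - ?d z) r \<le> (hardy_norm f)\<^sup>2 - torus_sqnorm f (\<sigma> * \<sigma>)"
    if r': "\<sigma> < r" "r < 1" for r
  proof -
    have r: "0 < r" "r < 1" using r' \<sigma> by auto
    have \<sigma>r: "0 < \<sigma> * r" "\<sigma> * r < 1" using r \<sigma> mult_strict_mono[of \<sigma> 1 r 1] by auto
    have "torus_sqnorm (\<lambda>z. f z - ?d z) r = torus_sqnorm f r + torus_sqnorm ?d r - 2 * Re (torus_inner f ?d r)"
    proof -
      have int: "integrable unit_cube (\<lambda>t. f (r *\<^sub>R torus_point t) * cnj (?d (r *\<^sub>R torus_point t)))"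
        using r by (intro integrable_unit_cube continuous_intros hf hd) auto
      show ?thesis
        unfolding torus_sqnorm_def torus_inner_def torus_mean_def norm_diff_square integral_Re[OF int, symmetric]
        using integrable_torus_sqnorm[OF hf r] integrable_torus_sqnorm[OF hd r] integrable_Re[OF int]
        by (simp del: times_complex.sel)
    qed
    also have "torus_inner f ?d r = torus_inner f f (\<sigma> * r)"
    proof -
      have "torus_inner f ?d r = torus_pairing f (standard_conjugation f) r (\<sigma> * \<sigma> * r)"
        using r by (simp add: torus_inner_def torus_pairing_def torus_mean_def hardy_dilation_def
            standard_conjugation_vcnj vcnj_scaleR)
      also have "\<dots> = torus_inner f f (\<sigma> * r)"
        unfolding torus_inner_eq_pairing using r s \<sigma>r mult_strict_mono[of "\<sigma> * \<sigma>" 1 r 1]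
        by (intro torus_pairing_cong hf holomorphic_vec_on_standard_conjugation) auto
      finally show ?thesis .
    qed
    also have "\<dots> = complex_of_real (torus_sqnorm f (\<sigma> * r))"
      by (simp add: torus_sqnorm_eq_inner)
    also have "torus_sqnorm ?d r = torus_sqnorm f (\<sigma> * \<sigma> * r)"
      by (rule torus_sqnorm_hardy_dilation[OF r])
    finally have "torus_sqnorm (\<lambda>z. f z - ?d z) r =
        torus_sqnorm f r + torus_sqnorm f (\<sigma> * \<sigma> * r) - 2 * torus_sqnorm f (\<sigma> * r)" by simp
    moreover have "torus_sqnorm f r \<le> (hardy_norm f)\<^sup>2"
      by (rule torus_sqnorm_le_hardy_norm[OF f r])
    moreover have "torus_sqnorm f (\<sigma> * \<sigma> * r) \<le> torus_sqnorm f (\<sigma> * r)"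
      using r \<sigma> \<sigma>r by (intro torus_sqnorm_mono hf) auto
    moreover have "torus_sqnorm f (\<sigma> * \<sigma>) \<le> torus_sqnorm f (\<sigma> * r)"
      using r' s \<sigma> \<sigma>r by (intro torus_sqnorm_mono hf) auto
    ultimately show ?thesis by simp
  qed
  then show "\<forall>\<^sub>F r in at_left 1. torus_sqnorm (\<lambda>z. f z - ?d z) r \<le> (hardy_norm f)\<^sup>2 - torus_sqnorm f (\<sigma> * \<sigma>)"
    using \<sigma> by (intro eventually_at_leftI[of \<sigma>]) auto
qed simp

section \<open>Sufficiency\<close>

text \<open>The identity holds factor by factor: (1 - c z)(1 - w v(z)) expands to 1 - c z - c w - (d
  - c^2) z w, which is symmetric in z and w.\<close>

lemma kernel_identity_of_form:
  fixes u :: "complex ^ 'n \<Rightarrow> complex" and v :: "'n \<Rightarrow> complex \<Rightarrow> complex"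
  assumes c: "\<And>i. norm (c i) < 1" and v1: "\<And>i x. norm x < 1 \<Longrightarrow> norm (v i x) < 1"
    and u: "\<And>z. z \<in> polydisc \<Longrightarrow> u z = a * (\<Prod>i\<in>UNIV. 1 / (1 - c i * z $ i))"
    and v: "\<And>i x. norm x < 1 \<Longrightarrow> v i x = ((d i - (c i)\<^sup>2) * x + c i) / (1 - c i * x)"
    and z: "z \<in> polydisc" and w: "w \<in> polydisc"
  shows "u z * (\<Prod>i\<in>UNIV. 1 / (1 - w $ i * v i (z $ i))) = u w * (\<Prod>i\<in>UNIV. 1 / (1 - v i (w $ i) * z $ i))"
proof -
  have "1 / (1 - c i * z $ i) * (1 / (1 - w $ i * v i (z $ i))) =
      1 / (1 - c i * w $ i) * (1 / (1 - v i (w $ i) * z $ i))" for i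
  proof -
    have n: "norm (z $ i) < 1" "norm (w $ i) < 1" using z w by (simp_all add: polydisc_def)
    have nz: "1 - c i * z $ i \<noteq> 0" "1 - c i * w $ i \<noteq> 0"
      by (rule one_minus_mult_neq_0[OF c less_imp_le[OF n(1)]])
         (rule one_minus_mult_neq_0[OF c less_imp_le[OF n(2)]])
    have "(1 - c i * z $ i) * v i (z $ i) = (d i - (c i)\<^sup>2) * z $ i + c i"
        "(1 - c i * w $ i) * v i (w $ i) = (d i - (c i)\<^sup>2) * w $ i + c i"
      using nz by (simp_all add: v n)
    then have "(1 - c i * z $ i) * (1 - w $ i * v i (z $ i)) = (1 - c i * w $ i) * (1 - v i (w $ i) * z $ i)"
      by algebra
    then show ?thesis by simp
  qed
  then have "(\<Prod>i\<in>UNIV. 1 / (1 - c i * z $ i)) * (\<Prod>i\<in>UNIV. 1 / (1 - w $ i * v i (z $ i))) =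
      (\<Prod>i\<in>UNIV. 1 / (1 - c i * w $ i)) * (\<Prod>i\<in>UNIV. 1 / (1 - v i (w $ i) * z $ i))"
    by (simp only: prod.distrib[symmetric])
  then show ?thesis by (simp only: u[OF z] u[OF w] mult.assoc)
qed

text \<open>Cauchy's formula writes the dilate of k as an average of kernels, the kernel identity
  moves V from the variable of g to the averaging variable, and after Fubini the inner integral
  reproduces g.\<close>

lemma torus_inner_weighted_composition_dilation:
  fixes u :: "complex ^ 'n \<Rightarrow> complex" and v :: "'n \<Rightarrow> complex \<Rightarrow> complex"
  assumes u: "u holomorphic_vec_on polydisc"
    and v: "\<And>j. continuous_on (ball 0 1) (v j)" and v1: "\<And>i x. norm x < 1 \<Longrightarrow> norm (v i x) < 1"
    and id: "\<And>z w. z \<in> polydisc \<Longrightarrow> w \<in> polydisc \<Longrightarrow>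
      u z * (\<Prod>i\<in>UNIV. 1 / (1 - w $ i * v i (z $ i))) = u w * (\<Prod>i\<in>UNIV. 1 / (1 - v i (w $ i) * z $ i))"
    and k: "k holomorphic_vec_on polydisc" and g: "g holomorphic_vec_on polydisc"
    and \<sigma>: "0 < \<sigma>" "\<sigma> < 1" and r: "0 < r" "r < 1"
  defines "V \<equiv> \<lambda>z. \<chi> j. v j (z $ j)"
  shows "torus_inner (weighted_composition u V (hardy_dilation (\<sigma> * \<sigma>) k)) g r =
    (\<integral>x. k (\<sigma> *\<^sub>R torus_point x) * u (\<sigma> *\<^sub>R vcnj (torus_point x)) *
      cnj (g ((r * r) *\<^sub>R vcnj (V (\<sigma> *\<^sub>R vcnj (torus_point x))))) \<partial>unit_cube)"
proof -
  have V: "V z \<in> polydisc" if "z \<in> polydisc" for z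
    using that v1 by (simp add: V_def polydisc_def)
  define p where "p x = \<sigma> *\<^sub>R vcnj (torus_point x)" for x :: "real ^ 'n"
  define e where "e y = r *\<^sub>R torus_point y" for y :: "real ^ 'n"
  have p: "p x \<in> polydisc" for x using \<sigma> by (simp add: p_def)
  have e: "e y \<in> polydisc" for y using r by (simp add: e_def)
  define K where "K x y = (\<Prod>i\<in>UNIV. 1 / (1 - V (p x) $ i * e y $ i))" for x y
  have Vp1: "norm (V (p x) $ i) < 1" and e1: "norm (e y $ i) < 1" for x y i
    using V[OF p[of x]] e[of y] by (simp_all add: polydisc_def)
  have nz: "1 - V (p x) $ i * e y $ i \<noteq> 0" for x y i
    using e1[of y i] by (intro one_minus_mult_neq_0 Vp1) simp
  have contV: "continuous_on S (\<lambda>x. V (p (h x)) $ i)" if "continuous_on S h" for S h i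
  proof -
    have "continuous_on S (\<lambda>x. v i (p (h x) $ i))"
      using p unfolding polydisc_def p_def
      by (intro continuous_on_compose2[OF v[of i]] continuous_intros that) auto
    then show ?thesis by (simp add: V_def)
  qed
  have cont_p: "continuous_on S (\<lambda>x. p (h x))" and cont_e: "continuous_on S (\<lambda>x. e (h x))"
    if "continuous_on S h" for S h
    using that by (auto simp: p_def e_def intro!: continuous_intros)
  have "torus_inner (weighted_composition u V (hardy_dilation (\<sigma> * \<sigma>) k)) g r =
      (\<integral>y. u (e y) * k (\<sigma> *\<^sub>R (\<sigma> *\<^sub>R V (e y))) * cnj (g (e y)) \<partial>unit_cube)"
    using e V by (simp add: torus_inner_def torus_mean_def e_def[symmetric] weighted_composition_def hardy_dilation_def)
  also have "\<dots> = (\<integral>y. (\<integral>x. k (\<sigma> *\<^sub>R torus_point x) * (u (p x) * K x y) * cnj (g (e y)) \<partial>unit_cube) \<partial>unit_cube)"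
  proof (intro Bochner_Integration.integral_cong refl)
    fix y
    have "\<sigma> *\<^sub>R V (e y) \<in> polydisc" using \<sigma> by (intro polydisc_scaleR V e) auto
    \<comment> \<open>Moving the factor \<sigma> of the evaluation point onto the conjugated torus
      point turns the Cauchy kernel into the left-hand product of the kernel identity, with
      \<open>p x\<close> in the role of w.\<close>
    from torus_Cauchy[OF k \<sigma> this]
    have "u (e y) * k (\<sigma> *\<^sub>R (\<sigma> *\<^sub>R V (e y))) = u (e y) *
        (\<integral>x. k (\<sigma> *\<^sub>R torus_point x) * (\<Prod>i\<in>UNIV. 1 / (1 - p x $ i * v i (e y $ i))) \<partial>unit_cube)"
      by (simp add: torus_mean_def p_def V_def mult_ac)
    also have "\<dots> = (\<integral>x. k (\<sigma> *\<^sub>R torus_point x) * (u (p x) * K x y) \<partial>unit_cube)"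
      unfolding integral_mult_right_zero[symmetric]
    proof (intro Bochner_Integration.integral_cong refl)
      fix x
      show "u (e y) * (k (\<sigma> *\<^sub>R torus_point x) * (\<Prod>i\<in>UNIV. 1 / (1 - p x $ i * v i (e y $ i)))) =
          k (\<sigma> *\<^sub>R torus_point x) * (u (p x) * K x y)"
        using id[OF e p, of y x] by (simp add: K_def V_def mult_ac)
    qed
    finally show "u (e y) * k (\<sigma> *\<^sub>R (\<sigma> *\<^sub>R V (e y))) * cnj (g (e y)) =
        (\<integral>x. k (\<sigma> *\<^sub>R torus_point x) * (u (p x) * K x y) * cnj (g (e y)) \<partial>unit_cube)"
      by simp
  qed
  also have "\<dots> = (\<integral>x. (\<integral>y. k (\<sigma> *\<^sub>R torus_point x) * (u (p x) * K x y) * cnj (g (e y)) \<partial>unit_cube) \<partial>unit_cube)"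
    unfolding K_def
    by (intro Fubini_unit_cube, unfold case_prod_beta)
       (intro continuous_intros contV cont_p cont_e k u g nz ballI p e; use \<sigma> in simp)
  also have "\<dots> = (\<integral>x. k (\<sigma> *\<^sub>R torus_point x) * u (p x) * cnj (g ((r * r) *\<^sub>R vcnj (V (p x)))) \<partial>unit_cube)"
  proof (intro Bochner_Integration.integral_cong refl)
    fix x
    \<comment> \<open>As a function of \<open>e y\<close>, \<open>K x y\<close> is the reproducing
      kernel at \<open>vcnj (V (p x))\<close>.\<close>
    have "torus_inner (hardy_kernel (vcnj (V (p x)))) g r = cnj (g ((r * r) *\<^sub>R vcnj (V (p x))))"
      using torus_inner_hardy_kernel[OF g, of "vcnj (V (p x))" r] r V p
      by (subst torus_inner_commute) simp
    moreover have "torus_inner (hardy_kernel (vcnj (V (p x)))) g r = (\<integral>y. K x y * cnj (g (e y)) \<partial>unit_cube)"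
      using e by (simp add: torus_inner_def torus_mean_def e_def[symmetric] hardy_kernel_def K_def)
    moreover have "(\<integral>y. k (\<sigma> *\<^sub>R torus_point x) * (u (p x) * K x y) * cnj (g (e y)) \<partial>unit_cube) =
        k (\<sigma> *\<^sub>R torus_point x) * u (p x) * (\<integral>y. K x y * cnj (g (e y)) \<partial>unit_cube)"
      by (simp add: mult.assoc flip: integral_mult_right_zero)
    ultimately show "(\<integral>y. k (\<sigma> *\<^sub>R torus_point x) * (u (p x) * K x y) * cnj (g (e y)) \<partial>unit_cube) =
        k (\<sigma> *\<^sub>R torus_point x) * u (p x) * cnj (g ((r * r) *\<^sub>R vcnj (V (p x))))"
      by simp
  qed
  finally show ?thesis by (simp add: p_def)
qed

text \<open>This is the previous formula with r tending to 1. In its right-hand side r occurs only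
  through the argument of g, which stays in the polydisc even at r = 1, so dominated convergence
  applies although k is sampled only at radius \<sigma>.\<close>

lemma hardy_inner_weighted_composition_dilation:
  fixes u :: "complex ^ 'n \<Rightarrow> complex" and v :: "'n \<Rightarrow> complex \<Rightarrow> complex"
  assumes u: "u holomorphic_vec_on polydisc"
    and v: "\<And>j. continuous_on (ball 0 1) (v j)" and v1: "\<And>i x. norm x < 1 \<Longrightarrow> norm (v i x) < 1"
    and id: "\<And>z w. z \<in> polydisc \<Longrightarrow> w \<in> polydisc \<Longrightarrow>
      u z * (\<Prod>i\<in>UNIV. 1 / (1 - w $ i * v i (z $ i))) = u w * (\<Prod>i\<in>UNIV. 1 / (1 - v i (w $ i) * z $ i))"
    and T: "T = weighted_composition u (\<lambda>z. \<chi> j. v j (z $ j))"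
    and bounded: "bounded_hardy_operator T"
    and k: "k \<in> hardy_space" and g: "g \<in> hardy_space" and \<sigma>: "0 < \<sigma>" "\<sigma> < 1"
  shows "hardy_inner (T (hardy_dilation (\<sigma> * \<sigma>) k)) g =
    torus_inner k (standard_conjugation (T (standard_conjugation g))) \<sigma>"
proof -
  define V where "V z = (\<chi> j. v j (z $ j))" for z :: "complex ^ 'n"
  have V: "V z \<in> polydisc" if "z \<in> polydisc" for z
    using that v1 by (simp add: V_def polydisc_def)
  note hk = hardy_spaceD(1)[OF k] and hg = hardy_spaceD(1)[OF g]
  define p where "p x = \<sigma> *\<^sub>R vcnj (torus_point x)" for x :: "real ^ 'n"
  have p: "p x \<in> polydisc" for x using \<sigma> by (simp add: p_def)
  have cont_p: "continuous_on S (\<lambda>x. p (h x))" if "continuous_on S h" for S h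
    using that by (auto simp: p_def intro!: continuous_intros)
  have contV: "continuous_on S (\<lambda>x. V (p (h x)))" if "continuous_on S h" for S h
    unfolding V_def
  proof (rule continuous_on_vec_lambda)
    show "continuous_on S (\<lambda>x. v i (p (h x) $ i))" for i
      using p unfolding polydisc_def p_def
      by (intro continuous_on_compose2[OF v[of i]] continuous_intros that) auto
  qed
  define G where "G \<rho> x = k (\<sigma> *\<^sub>R torus_point x) * u (p x) * cnj (g (\<rho> *\<^sub>R vcnj (V (p x))))" for \<rho> x
  have cont_G: "continuous_on (S :: ('a :: topological_space) set) (\<lambda>x. G (\<rho> x) (h x))"
    if "continuous_on S \<rho>" "continuous_on S h" and le1: "\<And>x. x \<in> S \<Longrightarrow> \<bar>\<rho> x\<bar> \<le> 1" for S \<rho> h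
    unfolding G_def
  proof (intro continuous_intros hk hg u cont_p contV that)
    show "\<rho> x *\<^sub>R vcnj (V (p (h x))) \<in> polydisc" if "x \<in> S" for x
      using \<open>x \<in> S\<close> by (intro polydisc_scaleR le1) (simp_all add: V p)
  qed (use \<sigma> p in auto)
  \<comment> \<open>Dominated convergence runs along a sequence of radii; the summand 2 makes
    \<open>X 0\<close> equal to 1/2 and hence positive.\<close>
  define X where "X n = 1 - 1 / (real n + 2)" for n
  have X: "0 < X n" "X n < 1" for n by (simp_all add: X_def divide_less_eq)
  have XX: "\<bar>X n * X n\<bar> \<le> 1" for n
    using X[of n] by (simp add: abs_mult mult_le_one)
  have "X \<longlonglongrightarrow> 1 - 0"
    unfolding X_def by (intro tendsto_diff tendsto_const) real_asymp
  then have X1: "X \<longlonglongrightarrow> 1" by simp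
  then have X_left: "filterlim X (at_left 1) sequentially"
    unfolding filterlim_at using X by (auto intro!: always_eventually simp: less_imp_neq)
  \<comment> \<open>Since \<open>p x\<close> has radius \<sigma> < 1, G is continuous up to \<rho> =
    1 and bounded on a compact set; this bound dominates.\<close>
  obtain B where B: "\<And>\<rho> x. \<rho> \<in> {0..1} \<Longrightarrow> x \<in> cbox 0 1 \<Longrightarrow> norm (G \<rho> x) \<le> B"
  proof -
    have "continuous_on ({0..1} \<times> cbox 0 1) (\<lambda>q. G (fst q) (snd q))"
      by (intro cont_G continuous_intros) auto
    then have "bounded ((\<lambda>q. G (fst q) (snd q)) ` ({0..1} \<times> cbox 0 1))"
      by (intro compact_imp_bounded compact_continuous_image compact_Times) auto
    then show ?thesis using that by (force simp: bounded_iff)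
  qed
  have "(\<lambda>n. \<integral>x. G (X n * X n) x \<partial>unit_cube) \<longlonglongrightarrow> (\<integral>x. G 1 x \<partial>unit_cube)"
  proof (rule integral_dominated_convergence[where w = "\<lambda>_. B"])
    show "G 1 \<in> borel_measurable unit_cube"
      by (rule borel_measurable_integrable[OF integrable_unit_cube]) (intro cont_G continuous_intros; simp)
    show "G (X n * X n) \<in> borel_measurable unit_cube" for n
      by (rule borel_measurable_integrable[OF integrable_unit_cube])
         (intro cont_G continuous_intros XX)
    show "integrable unit_cube (\<lambda>_ :: real ^ 'n. B)"
      by (intro integrable_unit_cube continuous_intros)
    show "AE x in unit_cube. (\<lambda>n. G (X n * X n) x) \<longlonglongrightarrow> G 1 x"
    proof (rule AE_I2)
      fix x
      have "continuous_on {0..1} (\<lambda>\<rho>. G \<rho> x)"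
        by (intro cont_G continuous_intros) auto
      then show "(\<lambda>n. G (X n * X n) x) \<longlonglongrightarrow> G 1 x"
      proof (rule continuous_on_tendsto_compose)
        show "(\<lambda>n. X n * X n) \<longlonglongrightarrow> 1" using tendsto_mult[OF X1 X1] by simp
        have "X n * X n \<in> {0..1}" for n using XX[of n] X[of n] by simp
        then show "\<forall>\<^sub>F n in sequentially. X n * X n \<in> {0..1}" by simp
      qed simp
    qed
    show "AE x in unit_cube. norm (G (X n * X n) x) \<le> B" for n
      using AE_unit_cube by eventually_elim (use B XX[of n] X[of n] in auto)
  qed
  moreover have "(\<integral>x. G (X n * X n) x \<partial>unit_cube) = torus_inner (T (hardy_dilation (\<sigma> * \<sigma>) k)) g (X n)" for n
    unfolding T using torus_inner_weighted_composition_dilation[OF u v v1 id hk hg \<sigma> X]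
    by (simp add: G_def p_def V_def)
  \<comment> \<open>The outer J cancels the conjugation in the inner product and moves the argument
    to \<open>p x\<close>; the inner J yields the conjugate of g at
    \<open>vcnj (V (p x))\<close>.\<close>
  moreover have "(\<integral>x. G 1 x \<partial>unit_cube) = torus_inner k (standard_conjugation (T (standard_conjugation g))) \<sigma>"
    unfolding torus_inner_def torus_mean_def G_def T
    using p by (simp add: weighted_composition_def standard_conjugation_vcnj vcnj_scaleR V_def[symmetric]
        p_def[symmetric] mult_ac)
  moreover have "(\<lambda>n. torus_inner (T (hardy_dilation (\<sigma> * \<sigma>) k)) g (X n)) \<longlonglongrightarrow>
      hardy_inner (T (hardy_dilation (\<sigma> * \<sigma>) k)) g"
  proof (rule filterlim_compose[OF hardy_inner_tendsto X_left])
    have "hardy_dilation (\<sigma> * \<sigma>) k \<in> hardy_space"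
      using \<sigma> mult_strict_mono[of \<sigma> 1 \<sigma> 1] by (intro hardy_space_hardy_dilation k) auto
    then show "T (hardy_dilation (\<sigma> * \<sigma>) k) \<in> hardy_space"
      using bounded by (simp add: bounded_hardy_operator_def)
  qed (rule g)
  ultimately show ?thesis by (simp add: LIMSEQ_unique)
qed

text \<open>Boundedness of T and the Cauchy-Schwarz inequality control the error of replacing k by
  its dilate, while the torus inner products on the right converge by themselves. The conclusion
  identifies J T J as the adjoint.\<close>

lemma hardy_inner_weighted_composition:
  fixes u :: "complex ^ 'n \<Rightarrow> complex" and v :: "'n \<Rightarrow> complex \<Rightarrow> complex"
  assumes u: "u holomorphic_vec_on polydisc"
    and v: "\<And>j. continuous_on (ball 0 1) (v j)" and v1: "\<And>i x. norm x < 1 \<Longrightarrow> norm (v i x) < 1"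
    and id: "\<And>z w. z \<in> polydisc \<Longrightarrow> w \<in> polydisc \<Longrightarrow>
      u z * (\<Prod>i\<in>UNIV. 1 / (1 - w $ i * v i (z $ i))) = u w * (\<Prod>i\<in>UNIV. 1 / (1 - v i (w $ i) * z $ i))"
    and T: "T = weighted_composition u (\<lambda>z. \<chi> j. v j (z $ j))"
    and bounded: "bounded_hardy_operator T"
    and k: "k \<in> hardy_space" and g: "g \<in> hardy_space"
  shows "hardy_inner (T k) g = hardy_inner k (standard_conjugation (T (standard_conjugation g)))"
proof -
  define h where "h = standard_conjugation (T (standard_conjugation g))"
  have T_space: "T f \<in> hardy_space" if "f \<in> hardy_space" for f
    using bounded that by (simp add: bounded_hardy_operator_def)
  have h: "h \<in> hardy_space"
    unfolding h_def by (intro hardy_space_standard_conjugation T_space g)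
  obtain C where C: "\<And>f. f \<in> hardy_space \<Longrightarrow> hardy_norm (T f) \<le> C * hardy_norm f"
    using bounded unfolding bounded_hardy_operator_def by blast
  \<comment> \<open>A nonnegative constant can be multiplied through the inequalities below.\<close>
  define C' where "C' = max C 0"
  have C': "0 \<le> C'" "hardy_norm (T f) \<le> C' * hardy_norm f" if "f \<in> hardy_space" for f
    using C[OF that] mult_right_mono[of C C' "hardy_norm f"] hardy_norm_nonneg[of f] by (auto simp: C'_def)
  have le: "norm (hardy_inner (T k) g - torus_inner k h \<sigma>) \<le>
      C' * sqrt ((hardy_norm k)\<^sup>2 - torus_sqnorm k (\<sigma> * \<sigma>)) * hardy_norm g" if \<sigma>: "0 < \<sigma>" "\<sigma> < 1" for \<sigma>
  proof -
    let ?d = "hardy_dilation (\<sigma> * \<sigma>) k"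
    have d: "?d \<in> hardy_space"
      using \<sigma> mult_strict_mono[of \<sigma> 1 \<sigma> 1] by (intro hardy_space_hardy_dilation k) auto
    have "hardy_inner (T k) g - torus_inner k h \<sigma> = hardy_inner (T k) g - hardy_inner (T ?d) g"
      unfolding h_def using hardy_inner_weighted_composition_dilation[OF u v v1 id T bounded k g \<sigma>] by simp
    also have "\<dots> = hardy_inner (\<lambda>z. T k z - T ?d z) g"
      by (rule hardy_inner_diff[symmetric]) (intro T_space k d g)+
    also have "(\<lambda>z. T k z - T ?d z) = T (\<lambda>z. k z - ?d z)"
      by (simp add: T weighted_composition_def fun_eq_iff right_diff_distrib)
    also have "norm (hardy_inner (T (\<lambda>z. k z - ?d z)) g) \<le> hardy_norm (T (\<lambda>z. k z - ?d z)) * hardy_norm g"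
      by (intro hardy_Cauchy_Schwarz T_space hardy_space_diff k d g)
    also have "\<dots> \<le> C' * hardy_norm (\<lambda>z. k z - ?d z) * hardy_norm g"
      by (intro mult_right_mono C' hardy_space_diff k d hardy_norm_nonneg)
    also have "\<dots> \<le> C' * sqrt ((hardy_norm k)\<^sup>2 - torus_sqnorm k (\<sigma> * \<sigma>)) * hardy_norm g"
      using C'(1)[OF k] by (intro mult_right_mono mult_left_mono real_le_rsqrt hardy_norm_dilation_diff k \<sigma> hardy_norm_nonneg)
    finally show ?thesis .
  qed
  have "filterlim (\<lambda>\<sigma>. \<sigma> * \<sigma>) (at_left 1) (at_left (1::real))"
    unfolding filterlim_at
  proof
    have "((\<lambda>\<sigma>. \<sigma> * \<sigma>) \<longlongrightarrow> 1 * 1) (at_left (1::real))" by (intro tendsto_intros)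
    then show "((\<lambda>\<sigma>. \<sigma> * \<sigma>) \<longlongrightarrow> 1) (at_left (1::real))" by simp
    show "\<forall>\<^sub>F \<sigma> in at_left (1::real). \<sigma> * \<sigma> \<in> {..<1} \<and> \<sigma> * \<sigma> \<noteq> 1"
    proof (rule eventually_at_leftI[of 0])
      fix \<sigma> :: real assume "\<sigma> \<in> {0<..<1}"
      then have "\<sigma> * \<sigma> < 1" using mult_strict_mono[of \<sigma> 1 \<sigma> 1] by simp
      then show "\<sigma> * \<sigma> \<in> {..<1} \<and> \<sigma> * \<sigma> \<noteq> 1" by simp
    qed simp
  qed
  from filterlim_compose[OF hardy_norm_tendsto[OF k] this]
  have "((\<lambda>\<sigma>. C' * sqrt ((hardy_norm k)\<^sup>2 - torus_sqnorm k (\<sigma> * \<sigma>)) * hardy_norm g) \<longlongrightarrow>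
      C' * sqrt ((hardy_norm k)\<^sup>2 - (hardy_norm k)\<^sup>2) * hardy_norm g) (at_left 1)"
    by (intro tendsto_intros)
  then have "((\<lambda>\<sigma>. C' * sqrt ((hardy_norm k)\<^sup>2 - torus_sqnorm k (\<sigma> * \<sigma>)) * hardy_norm g) \<longlongrightarrow> 0) (at_left 1)"
    by simp
  then have "((\<lambda>\<sigma>. hardy_inner (T k) g - torus_inner k h \<sigma>) \<longlongrightarrow> 0) (at_left 1)"
    by (rule Lim_null_comparison[rotated]) (use le in \<open>auto intro!: eventually_at_leftI[of 0]\<close>)
  moreover have "((\<lambda>\<sigma>. hardy_inner (T k) g - torus_inner k h \<sigma>) \<longlongrightarrow>
      hardy_inner (T k) g - hardy_inner k h) (at_left 1)"
    by (intro tendsto_intros hardy_inner_tendsto k h)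
  ultimately have "hardy_inner (T k) g - hardy_inner k h = 0"
    by (intro tendsto_unique[of "at_left (1::real)"]) auto
  then show ?thesis by (simp add: h_def)
qed

theorem theorem2p1:
  fixes u :: "complex ^ 'n \<Rightarrow> complex"
    and v :: "'n \<Rightarrow> complex \<Rightarrow> complex"
    and a :: complex and c d :: "'n \<Rightarrow> complex"
  assumes u_analytic: "u holomorphic_vec_on polydisc"
    and u_nonzero: "\<exists>z\<in>polydisc. u z \<noteq> 0"
    and v_analytic: "\<And>j. v j holomorphic_on ball 0 1"
    and v_self_map: "\<And>j. v j ` ball 0 1 \<subseteq> ball 0 1"
    and bounded: "bounded_hardy_operator (weighted_composition u (\<lambda>z. \<chi> j. v j (z $ j)))"
    and a: "a = u 0"
    and c: "\<And>j. c j = v j 0"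
    and d: "\<And>j. d j = deriv (v j) 0"
  shows "J_symmetric (weighted_composition u (\<lambda>z. \<chi> j. v j (z $ j))) \<longleftrightarrow>
      (\<forall>z\<in>polydisc. u z = a * (\<Prod>i\<in>UNIV. 1 / (1 - c i * z $ i))) \<and>
      (\<forall>j. \<forall>z\<in>ball 0 1. v j z = ((d j - (c j)\<^sup>2) * z + c j) / (1 - c j * z))"
    (is "J_symmetric ?T \<longleftrightarrow> ?form")
proof
  assume "J_symmetric ?T"
  then show ?form
    unfolding a c d using J_symmetric_imp_form[where v = v, OF u_nonzero v_analytic v_self_map] by blast
next
  assume form: ?form
  have v1: "norm (v j x) < 1" if "norm x < 1" for j x
    using v_self_map[of j] that by (auto simp: image_subset_iff)
  have c1: "norm (c j) < 1" for j
    using v1[of 0 j] by (simp add: c)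
  have id: "u z * (\<Prod>i\<in>UNIV. 1 / (1 - w $ i * v i (z $ i))) = u w * (\<Prod>i\<in>UNIV. 1 / (1 - v i (w $ i) * z $ i))"
    if "z \<in> polydisc" "w \<in> polydisc" for z w
    by (rule kernel_identity_of_form[OF c1 v1 _ _ that, where a = a and d = d]) (use form in auto)
  have vc: "continuous_on (ball 0 1) (v j)" for j
    by (rule holomorphic_on_imp_continuous_on[OF v_analytic])
  show "J_symmetric ?T"
    unfolding J_symmetric_def
  proof (intro conjI ballI bounded)
    fix f :: "complex ^ 'n \<Rightarrow> complex" assume f: "f \<in> hardy_space"
    \<comment> \<open>The adjoint relation is used with g = J f, where J applied twice
      cancels.\<close>
    have "hardy_adjoint ?T (standard_conjugation f) = standard_conjugation (?T f)"
    proof (rule hardy_adjoint_eqI)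
      show "standard_conjugation (?T f) \<in> hardy_space"
        using bounded f by (intro hardy_space_standard_conjugation) (simp add: bounded_hardy_operator_def)
      show "hardy_inner (?T k) (standard_conjugation f) = hardy_inner k (standard_conjugation (?T f))"
        if "k \<in> hardy_space" for k
        using hardy_inner_weighted_composition[OF u_analytic vc v1 id refl bounded that
            hardy_space_standard_conjugation[OF f]] by simp
    qed
    then show "?T f = standard_conjugation (hardy_adjoint ?T (standard_conjugation f))"
      by simp
  qed
qed

end
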